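(* Suppose the generalized Taft algebra $T_n(\lambda,m,0)$ acts linearly and inner faithfully on the quantum affine space $A=\Bbbk_{\mathbf p}[u_1,\dots,u_t]$. Assume that $m\ge 3$, $t\ge 3$, and $\operatorname{ord}(p_{ij})\ge 3$ for all $i\ne j$. Then the action is a trivial extension of an action on some quantum plane subalgebra $A_{ij}$ ($i,j$ distinct) or on some quantum affine $3$-space subalgebra $A_{ijk}$ ($i,j,k$ distinct).
   Context: $\Bbbk$ is an algebraically closed field of characteristic zero; $\operatorname{ord}$ denotes multiplicative order in $\Bbbk^\times$. Standing assumption: the parameters $p_{ij}$ ($i\neq j$) are roots of unity. Quantum affine space: for $\mathbf p=(p_{ij})\in M_t(\Bbbk^\times)$ with $p_{ii}=1$ and $p_{ij}=p_{ji}^{-1}$, $\Bbbk_{\mathbf p}[u_1,\dots,u_t]$ is generated by $u_1,\dots,u_t$ with relations $u_iu_j=p_{ij}u_ju_i$, graded with $\deg u_i=1$. For $I\subset\{1,\dots,t\}$, $A_I$ is the subalgebra generated by the $u_i$, $i\in I$; $A_{ij}=A_{\{i,j\}}$ and $A_{ijk}=A_{\{i,j,k\}}$. Generalized Taft algebra: for $m\mid n$ and $\lambda$ a primitive $m$th root of unity, $T_n(\lambda,m,0)$ is the Hopf algebra generated by a grouplike $g$ and $x$ with $\Delta(x)=g\otimes x+x\otimes 1$, with relations $g^n=1$, $x^m=0$, $gx=\lambda xg$. Actions: a Hopf algebra $H$ acts on $A$ if $A$ is a left $H$-module algebra; the action is inner faithful if no nonzero Hopf ideal of $H$ annihilates $A$;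 it is linear if $g$ and $x$ map $A_{(1)}=\operatorname{Span}_\Bbbk\{u_1,\dots,u_t\}$ into itself. Trivial extensions: the action of $T_n(\lambda,m,0)$ on $A$ is a trivial extension of an action on $A_I$ if it restricts to an action on $A_I$ and $x\cdot u_\ell=0$ for all $\ell\notin I$. For an action on a quantum plane $A_{ij}$, the action on $A_{ij}$ is taken (after possibly swapping $i$ and $j$) to be $g\cdot u_i=p_{ij}u_i$, $g\cdot u_j=\lambda^{-1}p_{ij}u_j$, $x\cdot u_i=0$, $x\cdot u_j=\eta u_i$ with $\eta\in\Bbbk^\times$. A trivial extension of an action on the quantum affine $3$-space $A_{ijk}$ means: $g$ acts diagonally on $A$ (each $u_\ell$ is an eigenvector of $g$), $x\cdot u_j=\eta_{ij}u_i$ and $x\cdot u_k=\eta_{jk}u_j$ with $\eta_{ij},\eta_{jk}\in\Bbbk^\times$, and $x\cdot u_\ell=0$ for all $\ell\ne j,k$. *)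

theory Defs
  imports
    Complex_Main
    "HOL-Library.Cardinality"
    "HOL-Library.Poly_Mapping"
    "HOL-Computational_Algebra.Polynomial"
begin

section \<open>Roots of unity\<close>

definition root_of_unity :: "'k::field \<Rightarrow> bool" where
  "root_of_unity z \<longleftrightarrow> (\<exists>k>0. z ^ k = 1)"

text \<open>Multiplicative order; only meaningful for roots of unity.\<close>

definition mult_ord :: "'k::field \<Rightarrow> nat" where
  "mult_ord z = (LEAST k. 0 < k \<and> z ^ k = 1)"

definition primitive_root_of_unity :: "nat \<Rightarrow> 'k::field \<Rightarrow> bool" where
  "primitive_root_of_unity m z \<longleftrightarrow> root_of_unity z \<and> mult_ord z = m"


section \<open>Formal linear combinations\<close>

definition fscale :: "'k::field \<Rightarrow> ('b \<Rightarrow>\<^sub>0 'k) \<Rightarrow> ('b \<Rightarrow>\<^sub>0 'k)" where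
  "fscale c = Poly_Mapping.map ((*) c)"

lemma lookup_fscale [simp]: "Poly_Mapping.lookup (fscale c s) b = c * Poly_Mapping.lookup s b"
  by (simp add: fscale_def Poly_Mapping.map.rep_eq when_def)

interpretation formal: vector_space "fscale :: 'k::field \<Rightarrow> ('b \<Rightarrow>\<^sub>0 'k) \<Rightarrow> ('b \<Rightarrow>\<^sub>0 'k)"
  by unfold_locales (auto intro!: poly_mapping_eqI simp: lookup_add algebra_simps)

text \<open>The linear extension of \<open>f\<close> from basis elements to formal linear combinations.\<close>

definition lin_ext ::
    "('k::field \<Rightarrow> 'v::ab_group_add \<Rightarrow> 'v) \<Rightarrow> ('b \<Rightarrow> 'v) \<Rightarrow> ('b \<Rightarrow>\<^sub>0 'k) \<Rightarrow> 'v" where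
  "lin_ext scale f s = (\<Sum>b\<in>Poly_Mapping.keys s. scale (Poly_Mapping.lookup s b) (f b))"


section \<open>Algebras, ideals and presentations\<close>

locale k_algebra = vector_space scale
  for scale :: "'k::field \<Rightarrow> 'a::ring_1 \<Rightarrow> 'a" +
  assumes scale_mult_left: "scale c (a * b) = scale c a * b"
    and scale_mult_right: "scale c (a * b) = a * scale c b"

text \<open>In a unital algebra two-sided ring ideals are automatically linear subspaces.\<close>

definition two_sided_ideal :: "'a::ring_1 set \<Rightarrow> bool" where
  "two_sided_ideal I \<longleftrightarrow>
     0 \<in> I \<and> (\<forall>a\<in>I. \<forall>b\<in>I. a + b \<in> I) \<and> (\<forall>a\<in>I. \<forall>r. r * a \<in> I \<and> a * r \<in> I)"

definition subalgebra :: "('k::field \<Rightarrow> 'a::ring_1 \<Rightarrow> 'a) \<Rightarrow> 'a set \<Rightarrow> bool" where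
  "subalgebra scale B \<longleftrightarrow>
     module.subspace scale B \<and> 1 \<in> B \<and> (\<forall>a\<in>B. \<forall>b\<in>B. a * b \<in> B)"

text \<open>
  The free monoid on \<open>'v\<close>, written additively, so that the convolution product makes
  \<open>'v word \<Rightarrow>\<^sub>0 'k\<close> the free associative algebra on \<open>'v\<close>.
\<close>

datatype 'v word = Word (letters: "'v list")

instantiation word :: (type) monoid_add
begin

definition zero_word :: "'a word" where
  "0 = Word []"

definition plus_word :: "'a word \<Rightarrow> 'a word \<Rightarrow> 'a word" where
  "v + w = Word (letters v @ letters w)"

instance
  by standard (auto simp: zero_word_def plus_word_def)

end

definition Gen :: "'v \<Rightarrow> ('v word \<Rightarrow>\<^sub>0 'k::field)" where
  "Gen v = Poly_Mapping.single (Word [v]) 1"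

definition Const :: "'k::field \<Rightarrow> ('v word \<Rightarrow>\<^sub>0 'k)" where
  "Const c = Poly_Mapping.single 0 c"

definition free_eval ::
    "('k::field \<Rightarrow> 'a::ring_1 \<Rightarrow> 'a) \<Rightarrow> ('v \<Rightarrow> 'a) \<Rightarrow> ('v word \<Rightarrow>\<^sub>0 'k) \<Rightarrow> 'a" where
  "free_eval scale u = lin_ext scale (\<lambda>w. prod_list (map u (letters w)))"

text \<open>
  The algebra is generated by the elements \<open>u v\<close> subject to exactly the relations
  \<open>r = 0\<close> for \<open>r \<in> R\<close>, i.e. evaluation induces an isomorphism from the free algebra modulo
  the two-sided ideal generated by \<open>R\<close>.
\<close>

definition presented_algebra ::
    "('k::field \<Rightarrow> 'a::ring_1 \<Rightarrow> 'a) \<Rightarrow> ('v \<Rightarrow> 'a) \<Rightarrow> ('v word \<Rightarrow>\<^sub>0 'k) set \<Rightarrow> bool" where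
  "presented_algebra scale u R \<longleftrightarrow>
     k_algebra scale \<and>
     surj (free_eval scale u) \<and>
     {f. free_eval scale u f = 0} = two_sided_ideal hull R"


section \<open>Quantum affine spaces\<close>

text \<open>The \<open>t\<close> generators are indexed by a finite type \<open>'i\<close>, so \<open>t = CARD('i)\<close>.\<close>

definition quantum_parameters :: "('i \<Rightarrow> 'i \<Rightarrow> 'k::field) \<Rightarrow> bool" where
  "quantum_parameters p \<longleftrightarrow>
     (\<forall>i j. p i j \<noteq> 0) \<and> (\<forall>i. p i i = 1) \<and> (\<forall>i j. p i j = inverse (p j i))"

definition quantum_affine_space ::
    "('i::finite \<Rightarrow> 'i \<Rightarrow> 'k::field) \<Rightarrow> ('k \<Rightarrow> 'a::ring_1 \<Rightarrow> 'a) \<Rightarrow> ('i \<Rightarrow> 'a) \<Rightarrow> bool" where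
  "quantum_affine_space p scale u \<longleftrightarrow>
     quantum_parameters p \<and>
     presented_algebra scale u
       {Gen i * Gen j - Const (p i j) * Gen j * Gen i | i j. True}"

definition generated_subalgebra ::
    "('k::field \<Rightarrow> 'a::ring_1 \<Rightarrow> 'a) \<Rightarrow> ('i \<Rightarrow> 'a) \<Rightarrow> 'i set \<Rightarrow> 'a set" where
  "generated_subalgebra scale u I = subalgebra scale hull (u ` I)"


section \<open>Tensor powers\<close>

text \<open>
  The tensor square of \<open>H\<close> is the vector space of formal linear combinations of pairs modulo the
  subspace spanned by the bilinearity relations. Elements of the tensor square are handled through
  representatives, compared modulo that subspace.
\<close>

abbreviation pure2 :: "'h \<Rightarrow> 'h \<Rightarrow> ('h \<times> 'h \<Rightarrow>\<^sub>0 'k::field)" where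
  "pure2 a b \<equiv> Poly_Mapping.single (a, b) 1"

abbreviation pure3 :: "'h \<Rightarrow> 'h \<Rightarrow> 'h \<Rightarrow> ('h \<times> 'h \<times> 'h \<Rightarrow>\<^sub>0 'k::field)" where
  "pure3 a b c \<equiv> Poly_Mapping.single (a, b, c) 1"

definition null2 :: "('k::field \<Rightarrow> 'h::ring_1 \<Rightarrow> 'h) \<Rightarrow> ('h \<times> 'h \<Rightarrow>\<^sub>0 'k) set" where
  "null2 scale = formal.span
     ({pure2 (a + a') b - pure2 a b - pure2 a' b | a a' b. True} \<union>
      {pure2 a (b + b') - pure2 a b - pure2 a b' | a b b'. True} \<union>
      {pure2 (scale c a) b - fscale c (pure2 a b) | c a b. True} \<union>
      {pure2 a (scale c b) - fscale c (pure2 a b) | c a b. True})"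

definition tensor2_eq ::
    "('k::field \<Rightarrow> 'h::ring_1 \<Rightarrow> 'h) \<Rightarrow> ('h \<times> 'h \<Rightarrow>\<^sub>0 'k) \<Rightarrow> ('h \<times> 'h \<Rightarrow>\<^sub>0 'k) \<Rightarrow> bool" where
  "tensor2_eq scale s t \<longleftrightarrow> s - t \<in> null2 scale"

text \<open>
  The trilinearity relations are the bilinearity relations in the first two factors and those
  in the last two factors, the remaining factor being fixed.
\<close>

definition null3 :: "('k::field \<Rightarrow> 'h::ring_1 \<Rightarrow> 'h) \<Rightarrow> ('h \<times> 'h \<times> 'h \<Rightarrow>\<^sub>0 'k) set" where
  "null3 scale = formal.span
     ({lin_ext fscale (\<lambda>(a, b). pure3 a b c) s | c s. s \<in> null2 scale} \<union>
      {lin_ext fscale (\<lambda>(b, c). pure3 a b c) s | a s. s \<in> null2 scale})"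

definition tensor3_eq ::
    "('k::field \<Rightarrow> 'h::ring_1 \<Rightarrow> 'h) \<Rightarrow>
      ('h \<times> 'h \<times> 'h \<Rightarrow>\<^sub>0 'k) \<Rightarrow> ('h \<times> 'h \<times> 'h \<Rightarrow>\<^sub>0 'k) \<Rightarrow> bool" where
  "tensor3_eq scale s t \<longleftrightarrow> s - t \<in> null3 scale"

text \<open>
  The product of the tensor square. The convolution product of \<open>Poly_Mapping\<close> is not the right
  one here, because it would add the basis pairs instead of multiplying them.
\<close>

definition tensor2_mult ::
    "('h::ring_1 \<times> 'h \<Rightarrow>\<^sub>0 'k::field) \<Rightarrow> ('h \<times> 'h \<Rightarrow>\<^sub>0 'k) \<Rightarrow> ('h \<times> 'h \<Rightarrow>\<^sub>0 'k)" where
  "tensor2_mult s t =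
     lin_ext fscale (\<lambda>(a, b). lin_ext fscale (\<lambda>(c, d). pure2 (a * c) (b * d)) t) s"


section \<open>Hopf algebras and their actions\<close>

text \<open>\<open>\<Delta> h\<close> is a representative, in the above sense, of the coproduct of \<open>h\<close>.\<close>

locale hopf_algebra = k_algebra scale
  for scale :: "'k::field \<Rightarrow> 'h::ring_1 \<Rightarrow> 'h" +
  fixes \<Delta> :: "'h \<Rightarrow> ('h \<times> 'h \<Rightarrow>\<^sub>0 'k)"
    and \<epsilon> :: "'h \<Rightarrow> 'k"
    and S :: "'h \<Rightarrow> 'h"
  assumes comult_add: "tensor2_eq scale (\<Delta> (a + b)) (\<Delta> a + \<Delta> b)"
    and comult_scale: "tensor2_eq scale (\<Delta> (scale c a)) (fscale c (\<Delta> a))"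
    and comult_one: "tensor2_eq scale (\<Delta> 1) (pure2 1 1)"
    and comult_mult: "tensor2_eq scale (\<Delta> (a * b)) (tensor2_mult (\<Delta> a) (\<Delta> b))"
    and counit_add: "\<epsilon> (a + b) = \<epsilon> a + \<epsilon> b"
    and counit_scale: "\<epsilon> (scale c a) = c * \<epsilon> a"
    and counit_one: "\<epsilon> 1 = 1"
    and counit_mult: "\<epsilon> (a * b) = \<epsilon> a * \<epsilon> b"
    and antipode_add: "S (a + b) = S a + S b"
    and antipode_scale: "S (scale c a) = scale c (S a)"
    and coassoc:
      "tensor3_eq scale
         (lin_ext fscale (\<lambda>(a, c). lin_ext fscale (\<lambda>(a', b). pure3 a' b c) (\<Delta> a)) (\<Delta> h))
         (lin_ext fscale (\<lambda>(a, c). lin_ext fscale (\<lambda>(b, c'). pure3 a b c') (\<Delta> c)) (\<Delta> h))"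
    and counit_left: "lin_ext scale (\<lambda>(a, b). scale (\<epsilon> a) b) (\<Delta> h) = h"
    and counit_right: "lin_ext scale (\<lambda>(a, b). scale (\<epsilon> b) a) (\<Delta> h) = h"
    and antipode_left: "lin_ext scale (\<lambda>(a, b). S a * b) (\<Delta> h) = scale (\<epsilon> h) 1"
    and antipode_right: "lin_ext scale (\<lambda>(a, b). a * S b) (\<Delta> h) = scale (\<epsilon> h) 1"
begin

definition grouplike :: "'h \<Rightarrow> bool" where
  "grouplike a \<longleftrightarrow> \<epsilon> a = 1 \<and> tensor2_eq scale (\<Delta> a) (pure2 a a)"

text \<open>
  The condition on \<open>\<Delta>\<close> says that the coproduct of \<open>I\<close> lies in \<open>I \<otimes> H + H \<otimes> I\<close>.
\<close>

definition hopf_ideal :: "'h set \<Rightarrow> bool" where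
  "hopf_ideal I \<longleftrightarrow>
     two_sided_ideal I \<and>
     (\<forall>h\<in>I. \<Delta> h \<in> formal.span ({pure2 a b | a b. a \<in> I \<or> b \<in> I} \<union> null2 scale)) \<and>
     (\<forall>h\<in>I. \<epsilon> h = 0) \<and>
     S ` I \<subseteq> I"

end

locale module_algebra =
  H: hopf_algebra scaleH \<Delta> \<epsilon> S + A: k_algebra scaleA
  for scaleH :: "'k::field \<Rightarrow> 'h::ring_1 \<Rightarrow> 'h"
    and \<Delta> :: "'h \<Rightarrow> ('h \<times> 'h \<Rightarrow>\<^sub>0 'k)"
    and \<epsilon> :: "'h \<Rightarrow> 'k"
    and S :: "'h \<Rightarrow> 'h"
    and scaleA :: "'k \<Rightarrow> 'a::ring_1 \<Rightarrow> 'a" +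
  fixes act :: "'h \<Rightarrow> 'a \<Rightarrow> 'a"
  assumes act_add_left: "act (h + h') a = act h a + act h' a"
    and act_scale_left: "act (scaleH c h) a = scaleA c (act h a)"
    and act_add_right: "act h (a + b) = act h a + act h b"
    and act_scale_right: "act h (scaleA c a) = scaleA c (act h a)"
    and act_one_left: "act 1 a = a"
    and act_mult_left: "act (h * h') a = act h (act h' a)"
    and act_one_right: "act h 1 = scaleA (\<epsilon> h) 1"
    and act_mult_right:
      "act h (a * b) = lin_ext scaleA (\<lambda>(h\<^sub>1, h\<^sub>2). act h\<^sub>1 a * act h\<^sub>2 b) (\<Delta> h)"
begin

definition inner_faithful :: bool where
  "inner_faithful \<longleftrightarrow>
     (\<forall>I. H.hopf_ideal I \<and> (\<forall>h\<in>I. \<forall>a. act h a = 0) \<longrightarrow> I = {0})"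

end


section \<open>Generalized Taft algebras\<close>

datatype taft_gen = Taft_g | Taft_x

definition generalized_taft ::
    "nat \<Rightarrow> 'k::field \<Rightarrow> nat \<Rightarrow> ('k \<Rightarrow> 'h::ring_1 \<Rightarrow> 'h) \<Rightarrow>
      ('h \<Rightarrow> ('h \<times> 'h \<Rightarrow>\<^sub>0 'k)) \<Rightarrow> ('h \<Rightarrow> 'k) \<Rightarrow> ('h \<Rightarrow> 'h) \<Rightarrow> 'h \<Rightarrow> 'h \<Rightarrow> bool" where
  "generalized_taft n lam m scale \<Delta> \<epsilon> S g x \<longleftrightarrow>
     0 < n \<and> m dvd n \<and> primitive_root_of_unity m lam \<and>
     hopf_algebra scale \<Delta> \<epsilon> S \<and>
     presented_algebra scale (case_taft_gen g x)
       {Gen Taft_g ^ n - 1, Gen Taft_x ^ m, Gen Taft_g * Gen Taft_x - Const lam * Gen Taft_x * Gen Taft_g} \<and>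
     hopf_algebra.grouplike scale \<Delta> \<epsilon> g \<and>
     tensor2_eq scale (\<Delta> x) (pure2 g x + pure2 x 1)"


section \<open>Linear actions and trivial extensions\<close>

definition linear_action ::
    "('k::field \<Rightarrow> 'a::ring_1 \<Rightarrow> 'a) \<Rightarrow> ('i \<Rightarrow> 'a) \<Rightarrow> ('h \<Rightarrow> 'a \<Rightarrow> 'a) \<Rightarrow> 'h \<Rightarrow> 'h \<Rightarrow> bool" where
  "linear_action scale u act g x \<longleftrightarrow>
     act g ` module.span scale (range u) \<subseteq> module.span scale (range u) \<and>
     act x ` module.span scale (range u) \<subseteq> module.span scale (range u)"

definition trivial_extension ::
    "('k::field \<Rightarrow> 'a::ring_1 \<Rightarrow> 'a) \<Rightarrow> ('i \<Rightarrow> 'a) \<Rightarrow> ('h \<Rightarrow> 'a \<Rightarrow> 'a) \<Rightarrow> 'h \<Rightarrow>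
      'i set \<Rightarrow> bool" where
  "trivial_extension scale u act x I \<longleftrightarrow>
     (\<forall>h. act h ` generated_subalgebra scale u I \<subseteq> generated_subalgebra scale u I) \<and>
     (\<forall>l. l \<notin> I \<longrightarrow> act x (u l) = 0)"

text \<open>
  Actions on a quantum plane are taken in the normal form below; it is not symmetric in \<open>i\<close> and
  \<open>j\<close>, so swapping the two generators means exchanging the two index arguments.
\<close>

definition plane_extension ::
    "('i \<Rightarrow> 'i \<Rightarrow> 'k::field) \<Rightarrow> 'k \<Rightarrow> ('k \<Rightarrow> 'a::ring_1 \<Rightarrow> 'a) \<Rightarrow> ('i \<Rightarrow> 'a) \<Rightarrow>
      ('h \<Rightarrow> 'a \<Rightarrow> 'a) \<Rightarrow> 'h \<Rightarrow> 'h \<Rightarrow> 'i \<Rightarrow> 'i \<Rightarrow> bool" where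
  "plane_extension p lam scale u act g x i j \<longleftrightarrow>
     trivial_extension scale u act x {i, j} \<and>
     act g (u i) = scale (p i j) (u i) \<and>
     act g (u j) = scale (inverse lam * p i j) (u j) \<and>
     act x (u i) = 0 \<and>
     (\<exists>\<eta>. \<eta> \<noteq> 0 \<and> act x (u j) = scale \<eta> (u i))"

definition three_space_extension ::
    "('k::field \<Rightarrow> 'a::ring_1 \<Rightarrow> 'a) \<Rightarrow> ('i \<Rightarrow> 'a) \<Rightarrow>
      ('h \<Rightarrow> 'a \<Rightarrow> 'a) \<Rightarrow> 'h \<Rightarrow> 'h \<Rightarrow> 'i \<Rightarrow> 'i \<Rightarrow> 'i \<Rightarrow> bool" where
  "three_space_extension scale u act g x i j k \<longleftrightarrow>
     trivial_extension scale u act x {i, j, k} \<and>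
     (\<forall>l. \<exists>\<alpha>. act g (u l) = scale \<alpha> (u l)) \<and>
     (\<exists>\<eta>. \<eta> \<noteq> 0 \<and> act x (u j) = scale \<eta> (u i)) \<and>
     (\<exists>\<eta>. \<eta> \<noteq> 0 \<and> act x (u k) = scale \<eta> (u j)) \<and>
     (\<forall>l. l \<noteq> j \<and> l \<noteq> k \<longrightarrow> act x (u l) = 0)"

end

theory Submission
  imports Defs
begin

text \<open>
  A linear action is given by the two matrices of \<open>g\<close> and \<open>x\<close> on the span of the generators, and
  the theorem is the solution of the equations for their entries. In degree two only the monomials
  \<open>u k * u l\<close> and \<open>u l * u k\<close> are dependent (\<open>quantum_affine_space_quadratic\<close>), so these
  equations can be read off from \<open>g\<close> and \<open>x\<close> preserving the relations \<open>u i * u j = p i j u j * u i\<close>.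

  As \<open>p i j \<noteq> 1\<close> for \<open>i \<noteq> j\<close>, the squares \<open>u k * u k\<close> force the matrix of \<open>g\<close> to be monomial:
  \<open>g\<close> sends \<open>u i\<close> to \<open>\<alpha> i u (\<sigma> i)\<close> for a permutation \<open>\<sigma>\<close> (\<open>act_g_monomial\<close>). If \<open>\<sigma>\<close> is
  not the identity, then the equations for \<open>x\<close>, together with \<open>g x = \<lambda> x g\<close>, only have the zero
  solution (\<open>vanish_if_moved\<close>); here \<open>p i j \<noteq> -1\<close> enters because it excludes transpositions. But
  \<open>x\<close> cannot act as zero: the ideal \<open>x H\<close> would then annihilate \<open>A\<close>, and it is a nonzero Hopf
  ideal (\<open>hopf_ideal_of_normal_skew_primitive\<close>, \<open>act_x_nonzero\<close>).

  Hence \<open>g\<close> is diagonal. View a nonzero matrix entry \<open>b k j\<close> of \<open>x\<close> as an edge from \<open>j\<close> to \<open>k\<close>.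
  Each edge forces \<open>\<alpha> k = \<lambda> * \<alpha> j\<close> and \<open>\<alpha> i = p i j * p k i\<close> for all \<open>i \<noteq> j\<close>
  (\<open>edge_eigenvalue\<close>). Comparing two edges shows that no index is the source or the target of two
  edges, since \<open>(p i j)\<^sup>2 \<noteq> 1\<close>, and that two distinct edges share exactly one index, since
  \<open>\<lambda>\<^sup>2 \<noteq> 1\<close>. The graph is therefore a single edge, a path of two edges or a triangle
  (\<open>edges_cases\<close>). The first two are the actions on a quantum plane and on a quantum affine
  3-space, and the triangle contradicts the nilpotency of \<open>x\<close>.
\<close>

section \<open>Linear extension and evaluation of free polynomials\<close>

lemma formal_sum_induct [case_names single add]:
  assumes "\<And>b c. P (Poly_Mapping.single b c)"
    and "\<And>s t. P s \<Longrightarrow> P t \<Longrightarrow> P (s + t)"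
  shows "P (s :: 'b \<Rightarrow>\<^sub>0 'k::comm_monoid_add)"
proof -
  have "P (\<Sum>b\<in>B. Poly_Mapping.single b (Poly_Mapping.lookup s b))" if "finite B" for B
    using that
  proof (induction B)
    case empty
    show ?case using assms(1)[of undefined 0] by simp
  qed (auto intro: assms)
  moreover have "(\<Sum>b\<in>Poly_Mapping.keys s. Poly_Mapping.single b (Poly_Mapping.lookup s b)) = s"
    by (rule poly_mapping_eqI)
      (auto simp: lookup_sum lookup_single when_def in_keys_iff sum.delta)
  ultimately show ?thesis by (metis finite_keys)
qed

context vector_space
begin

lemma lin_ext_superset:
  assumes "finite B" "Poly_Mapping.keys s \<subseteq> B"
  shows "lin_ext scale f s = (\<Sum>b\<in>B. scale (Poly_Mapping.lookup s b) (f b))"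
  unfolding lin_ext_def using assms
  by (intro sum.mono_neutral_left) (auto simp: in_keys_iff)

lemma lin_ext_single [simp]: "lin_ext scale f (Poly_Mapping.single b c) = scale c (f b)"
  by (simp add: lin_ext_def)

lemma lin_ext_zero [simp]: "lin_ext scale f 0 = 0"
  by (simp add: lin_ext_def)

lemma lin_ext_add: "lin_ext scale f (s + t) = lin_ext scale f s + lin_ext scale f t"
proof -
  let ?B = "Poly_Mapping.keys s \<union> Poly_Mapping.keys t"
  have "Poly_Mapping.keys (s + t) \<subseteq> ?B" by (rule keys_add)
  then show ?thesis
    by (simp add: lin_ext_superset[of ?B] lookup_add scale_left_distrib sum.distrib)
qed

lemma lin_ext_fscale: "lin_ext scale f (fscale c s) = scale c (lin_ext scale f s)"
proof -
  have "Poly_Mapping.keys (fscale c s) \<subseteq> Poly_Mapping.keys s" by (auto simp: in_keys_iff)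
  then show ?thesis
    by (simp add: lin_ext_superset[of "Poly_Mapping.keys s"] scale_sum_right)
qed

lemma lin_ext_diff: "lin_ext scale f (s - t) = lin_ext scale f s - lin_ext scale f t"
  by (metis add_diff_cancel diff_add_cancel lin_ext_add)

lemma lin_ext_sum: "lin_ext scale f (\<Sum>i\<in>I. s i) = (\<Sum>i\<in>I. lin_ext scale f (s i))"
  by (induction I rule: infinite_finite_induct) (auto simp: lin_ext_add)

lemma lin_ext_lin_ext:
  "lin_ext scale f (lin_ext fscale h s) = lin_ext scale (\<lambda>b. lin_ext scale f (h b)) s"
  by (simp add: lin_ext_def[of fscale] lin_ext_def[of scale _ s] lin_ext_sum lin_ext_fscale)

lemma linear_lin_ext:
  assumes "Vector_Spaces.linear scale scale h"
  shows "h (lin_ext scale f s) = lin_ext scale (\<lambda>b. h (f b)) s"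
  using assms
  by (simp add: lin_ext_def Vector_Spaces.linear_iff
      module_hom.sum[OF assms[unfolded linear_iff_module_hom]])

lemma lin_ext_mem:
  assumes "subspace W" "\<And>b. f b \<in> W"
  shows "lin_ext scale f s \<in> W"
  unfolding lin_ext_def using assms by (intro subspace_sum subspace_scale) auto

lemma lin_ext_plus_fun:
  "lin_ext scale (\<lambda>b. f b + h b) s = lin_ext scale f s + lin_ext scale h s"
  by (simp add: lin_ext_def scale_right_distrib sum.distrib)

lemma lin_ext_scale_fun:
  "lin_ext scale (\<lambda>b. scale c (f b)) s = scale c (lin_ext scale f s)"
  by (simp add: lin_ext_def scale_sum_right mult.commute)

lemma lin_ext_diff_fun:
  "lin_ext scale (\<lambda>b. f b - h b) s = lin_ext scale f s - lin_ext scale h s"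
  by (simp add: lin_ext_def scale_right_diff_distrib sum_subtractf)

end

lemma (in vector_space) subspace_lin_ext_vimage:
  assumes "subspace W"
  shows "formal.subspace {s. lin_ext scale f s \<in> W}"
  using assms
  by (auto simp: formal.subspace_def lin_ext_add lin_ext_fscale subspace_add subspace_scale subspace_0)

context k_algebra
begin

lemma lin_ext_mult_right: "lin_ext scale (\<lambda>b. f b * a) s = lin_ext scale f s * a"
  by (simp add: lin_ext_def sum_distrib_right scale_mult_left)

lemma lin_ext_mult_left: "lin_ext scale (\<lambda>b. a * f b) s = a * lin_ext scale f s"
  by (simp add: lin_ext_def sum_distrib_left scale_mult_right)

lemma free_eval_add: "free_eval scale u (f + h) = free_eval scale u f + free_eval scale u h"
  by (simp add: free_eval_def lin_ext_add)

lemma free_eval_zero: "free_eval scale u 0 = 0"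
  by (simp add: free_eval_def)

lemma free_eval_diff: "free_eval scale u (f - h) = free_eval scale u f - free_eval scale u h"
  by (simp add: free_eval_def lin_ext_diff)

lemma free_eval_sum: "free_eval scale u (\<Sum>i\<in>I. f i) = (\<Sum>i\<in>I. free_eval scale u (f i))"
  by (simp add: free_eval_def lin_ext_sum)

lemma free_eval_Gen: "free_eval scale u (Gen v) = u v"
  by (simp add: free_eval_def Gen_def)

lemma free_eval_Const: "free_eval scale u (Const c) = scale c 1"
  by (simp add: free_eval_def Const_def zero_word_def)

lemma scale_mult_scale: "scale c a * scale d b = scale (c * d) (a * b)"
  by (metis scale_mult_left scale_mult_right scale_scale)

lemma scale_one_mult: "scale c 1 * a = scale c a"
  by (simp flip: scale_mult_left)

lemma free_eval_mult: "free_eval scale u (f * h) = free_eval scale u f * free_eval scale u h"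
proof (induction f rule: formal_sum_induct)
  case (single v c)
  show ?case
  proof (induction h rule: formal_sum_induct)
    case (single w d)
    show ?case by (simp add: free_eval_def mult_single plus_word_def scale_mult_scale)
  qed (simp add: free_eval_add distrib_left)
qed (simp add: free_eval_add distrib_right)

lemma free_eval_one: "free_eval scale u 1 = 1"
  using free_eval_Const[of u 1] by (simp add: Const_def)

lemma free_eval_power: "free_eval scale u (f ^ k) = free_eval scale u f ^ k"
  by (induction k) (simp_all add: free_eval_one free_eval_mult)

lemmas free_eval_simps =
  free_eval_add free_eval_zero free_eval_diff free_eval_sum free_eval_Gen free_eval_Const
  free_eval_mult free_eval_one free_eval_power

lemma two_sided_ideal_free_eval_kernel: "two_sided_ideal {f. free_eval scale u f = 0}"
  by (simp add: two_sided_ideal_def free_eval_simps)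

lemma free_eval_in_subalgebra:
  assumes B: "subalgebra scale B" and u: "\<And>v. u v \<in> B"
  shows "free_eval scale u f \<in> B"
proof -
  have "prod_list (map u vs) \<in> B" for vs
    using B u by (induction vs) (auto simp: subalgebra_def)
  then show ?thesis
    using B unfolding free_eval_def subalgebra_def by (intro lin_ext_mem) auto
qed

end

text \<open>
  Statements about all elements of a presented algebra are reduced to the generators in this form:
  the elements with the desired property form a subalgebra.
\<close>

lemma presented_algebra_eq_UNIV:
  assumes "presented_algebra scale u R" "subalgebra scale B" "\<And>v. u v \<in> B"
  shows "B = UNIV"
proof -
  interpret k_algebra scale using assms(1) by (simp add: presented_algebra_def)
  have "range (free_eval scale u) \<subseteq> B"
    using free_eval_in_subalgebra[OF assms(2,3)] by auto
  then show ?thesis using assms(1) unfolding presented_algebra_def by auto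
qed

lemma presented_algebra_relation:
  assumes "presented_algebra scale u R" "r \<in> R"
  shows "free_eval scale u r = 0"
proof -
  have "r \<in> two_sided_ideal hull R" using assms(2) by (rule hull_inc)
  then show ?thesis using assms(1) by (auto simp: presented_algebra_def)
qed

text \<open>
  This universal property serves as a criterion for nonvanishing: an expression in the generators
  is nonzero as soon as it is nonzero for some elements of some algebra that satisfy the relations.
\<close>

lemma presented_algebra_universal:
  assumes P: "presented_algebra scale u R"
    and B: "k_algebra scale'" and R: "\<And>r. r \<in> R \<Longrightarrow> free_eval scale' v r = 0"
    and f: "free_eval scale u f = 0"
  shows "free_eval scale' v f = 0"
proof -
  have "two_sided_ideal hull R \<subseteq> {f. free_eval scale' v f = 0}"
    using R by (intro hull_minimal k_algebra.two_sided_ideal_free_eval_kernel[OF B]) auto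
  then show ?thesis using P f by (auto simp: presented_algebra_def)
qed


section \<open>Upper triangular matrices as a test algebra\<close>

text \<open>
  These matrices are large enough to detect everything needed from the two presentations: a
  nilpotent element that commutes with a diagonal one up to a scalar, and all linear combinations
  of the generators and of their pairwise products in a quantum affine space.
\<close>

datatype 'k triangular3 = Tri (e11: 'k) (e12: 'k) (e13: 'k) (e22: 'k) (e23: 'k) (e33: 'k)

instantiation triangular3 :: (field) ring_1
begin

definition "0 = Tri 0 0 0 0 0 0"
definition "1 = Tri 1 0 0 1 0 1"
definition "a + b =
  Tri (e11 a + e11 b) (e12 a + e12 b) (e13 a + e13 b) (e22 a + e22 b) (e23 a + e23 b) (e33 a + e33 b)"
definition "- a = Tri (- e11 a) (- e12 a) (- e13 a) (- e22 a) (- e23 a) (- e33 a)"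
definition "a - b =
  Tri (e11 a - e11 b) (e12 a - e12 b) (e13 a - e13 b) (e22 a - e22 b) (e23 a - e23 b) (e33 a - e33 b)"
definition "a * b =
  Tri (e11 a * e11 b) (e11 a * e12 b + e12 a * e22 b)
    (e11 a * e13 b + e12 a * e23 b + e13 a * e33 b)
    (e22 a * e22 b) (e22 a * e23 b + e23 a * e33 b) (e33 a * e33 b)"

instance
  by standard
    (simp_all add: zero_triangular3_def one_triangular3_def plus_triangular3_def
      uminus_triangular3_def minus_triangular3_def times_triangular3_def algebra_simps)

end

lemmas triangular3_defs =
  zero_triangular3_def one_triangular3_def plus_triangular3_def
  uminus_triangular3_def minus_triangular3_def times_triangular3_def

definition scale_triangular3 :: "'k::field \<Rightarrow> 'k triangular3 \<Rightarrow> 'k triangular3" where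
  "scale_triangular3 c a =
    Tri (c * e11 a) (c * e12 a) (c * e13 a) (c * e22 a) (c * e23 a) (c * e33 a)"

lemma k_algebra_triangular3: "k_algebra scale_triangular3"
  by unfold_locales (simp_all add: scale_triangular3_def triangular3_defs algebra_simps)

section \<open>Linear and quadratic relations in a quantum affine space\<close>

text \<open>
  The product of \<open>y i E\<^sub>1\<^sub>2 + z i E\<^sub>2\<^sub>3\<close> and \<open>y j E\<^sub>1\<^sub>2 + z j E\<^sub>2\<^sub>3\<close> is
  \<open>y i * z j E\<^sub>1\<^sub>3\<close>, so the hypothesis on \<open>y\<close> and \<open>z\<close> says exactly that these matrices satisfy
  the relations of the quantum affine space.
\<close>

lemma quantum_affine_space_test:
  fixes y z :: "'i::finite \<Rightarrow> 'k::field"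
  assumes A: "quantum_affine_space p scale u"
    and yz: "\<And>i j. y i * z j = p i j * (y j * z i)"
    and f: "free_eval scale u f = 0"
  shows "free_eval scale_triangular3 (\<lambda>i. Tri 0 (y i) 0 0 (z i) 0) f = 0"
proof (rule presented_algebra_universal[OF _ k_algebra_triangular3 _ f])
  interpret T: k_algebra "scale_triangular3 :: 'k \<Rightarrow> _" by (rule k_algebra_triangular3)
  show "presented_algebra scale u {Gen i * Gen j - Const (p i j) * Gen j * Gen i | i j. True}"
    using A unfolding quantum_affine_space_def by blast
  show "free_eval scale_triangular3 (\<lambda>i. Tri 0 (y i) 0 0 (z i) 0) r = 0"
    if r: "r \<in> {Gen i * Gen j - Const (p i j) * Gen j * Gen i | i j. True}" for r
  proof -
    obtain i j where "r = Gen i * Gen j - Const (p i j) * Gen j * Gen i" using r by blast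
    then show ?thesis using yz[of i j]
      by (simp add: T.free_eval_simps scale_triangular3_def triangular3_defs)
  qed
qed

lemma e12_sum: "e12 (\<Sum>i\<in>I. f i) = (\<Sum>i\<in>I. e12 (f i))"
  by (induction I rule: infinite_finite_induct) (auto simp: triangular3_defs)

lemma e13_sum: "e13 (\<Sum>i\<in>I. f i) = (\<Sum>i\<in>I. e13 (f i))"
  by (induction I rule: infinite_finite_induct) (auto simp: triangular3_defs)

lemma quantum_affine_space_linear_independent:
  fixes c :: "'i::finite \<Rightarrow> 'k::field"
  assumes A: "quantum_affine_space p scale u"
    and eq: "(\<Sum>i\<in>UNIV. scale (c i) (u i)) = 0"
  shows "c k = 0"
proof -
  interpret k_algebra scale
    using A unfolding quantum_affine_space_def presented_algebra_def by blast
  interpret T: k_algebra "scale_triangular3 :: 'k \<Rightarrow> _" by (rule k_algebra_triangular3)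
  have "free_eval scale u (\<Sum>i\<in>UNIV. Const (c i) * Gen i) = 0"
    using eq by (simp add: free_eval_simps scale_one_mult)
  from quantum_affine_space_test[OF A _ this, of "\<lambda>i. of_bool (i = k)" "\<lambda>_. 0"]
  have "e12 (\<Sum>i\<in>UNIV. scale_triangular3 (c i) (Tri 0 (of_bool (i = k)) 0 0 0 0)) = 0"
    by (simp add: T.free_eval_simps T.scale_one_mult) (simp add: triangular3_defs)
  then have "(\<Sum>i\<in>UNIV. c i * of_bool (i = k)) = 0"
    by (simp add: e12_sum scale_triangular3_def)
  then show ?thesis by simp
qed

text \<open>
  The relations only connect \<open>u k * u l\<close> with \<open>u l * u k\<close>, so in degree two the coefficients can
  be compared separately for each unordered pair of indices. For \<open>k = l\<close> the test matrices have
  \<open>y = z\<close> supported on \<open>{k}\<close>. For \<open>k \<noteq> l\<close> they are supported on \<open>{k, l}\<close>, where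
  \<open>y k * z l = p k l * (y l * z k)\<close> is the only condition, and it is met by \<open>y k = p k l\<close> with
  \<open>y l\<close>, \<open>z k\<close> and \<open>z l\<close> equal to \<open>1\<close>.
\<close>

lemma quantum_affine_space_quadratic:
  fixes c :: "'i::finite \<Rightarrow> 'i \<Rightarrow> 'k::field"
  assumes A: "quantum_affine_space p scale u"
    and eq: "(\<Sum>i\<in>UNIV. \<Sum>j\<in>UNIV. scale (c i j) (u i * u j)) = 0"
  shows "c k k = 0" and "p k l * c k l + c l k = 0"
proof -
  interpret k_algebra scale
    using A unfolding quantum_affine_space_def presented_algebra_def by blast
  interpret T: k_algebra "scale_triangular3 :: 'k \<Rightarrow> _" by (rule k_algebra_triangular3)
  have p: "p i i = 1" "p i j * p j i = 1" for i j
    using A unfolding quantum_affine_space_def quantum_parameters_def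
    by (blast, metis left_inverse)
  have ev: "free_eval scale u (\<Sum>i\<in>UNIV. \<Sum>j\<in>UNIV. Const (c i j) * (Gen i * Gen j)) = 0"
    using eq by (simp add: free_eval_simps scale_one_mult)
  have test: "(\<Sum>i\<in>UNIV. \<Sum>j\<in>UNIV. c i j * (y i * z j)) = 0"
    if "\<And>i j. y i * z j = p i j * (y j * z i)" for y z
  proof -
    have "e13 (\<Sum>i\<in>UNIV. \<Sum>j\<in>UNIV. scale_triangular3 (c i j)
        (Tri 0 (y i) 0 0 (z i) 0 * Tri 0 (y j) 0 0 (z j) 0)) = 0"
      using quantum_affine_space_test[OF A that ev]
      by (simp add: T.free_eval_simps T.scale_one_mult) (simp add: triangular3_defs)
    then show ?thesis by (simp add: e13_sum scale_triangular3_def triangular3_defs)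
  qed
  have diag: "c k k = 0" for k
  proof -
    have "(\<Sum>i\<in>UNIV. \<Sum>j\<in>UNIV. c i j * (of_bool (i = k) * of_bool (j = k))) = 0"
      by (rule test) (use p(1) in \<open>simp add: of_bool_def\<close>)
    then have "(\<Sum>i\<in>UNIV. of_bool (i = k) * (\<Sum>j\<in>UNIV. c i j * of_bool (j = k))) = 0"
      by (simp only: sum_distrib_left mult.left_commute)
    then show ?thesis by simp
  qed
  then show "c k k = 0" .
  show "p k l * c k l + c l k = 0"
  proof (cases "k = l")
    case True
    then show ?thesis using diag by simp
  next
    case kl: False
    define y where "y i = (if i = k then p k l else 0) + (if i = l then 1 else 0)" for i
    define z :: "'i \<Rightarrow> 'k" where "z i = (if i = k then 1 else 0) + (if i = l then 1 else 0)" for i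
    have vals: "y k = p k l" "y l = 1" "z k = 1" "z l = 1"
      "\<And>i. i \<noteq> k \<Longrightarrow> i \<noteq> l \<Longrightarrow> y i = 0" "\<And>i. i \<noteq> k \<Longrightarrow> i \<noteq> l \<Longrightarrow> z i = 0"
      using kl by (simp_all add: y_def z_def)
    have "y i * z j = p i j * (y j * z i)" for i j
    proof (cases "i \<in> {k, l} \<and> j \<in> {k, l}")
      case True
      then show ?thesis using vals p(1) p(2)[of l k] by (elim conjE insertE) auto
    next
      case False
      then have "y i = 0 \<and> z i = 0 \<or> y j = 0 \<and> z j = 0" using vals(5,6) by blast
      then show ?thesis by auto
    qed
    from test[OF this] have "(\<Sum>i\<in>UNIV. \<Sum>j\<in>UNIV. c i j * (y i * z j)) = 0" .
    also have "(\<Sum>i\<in>UNIV. \<Sum>j\<in>UNIV. c i j * (y i * z j))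
        = (\<Sum>i\<in>{k, l}. \<Sum>j\<in>UNIV. c i j * (y i * z j))"
      by (rule sum.mono_neutral_right) (simp_all add: vals(5))
    also have "\<dots> = (\<Sum>i\<in>{k, l}. \<Sum>j\<in>{k, l}. c i j * (y i * z j))"
      by (intro sum.cong refl sum.mono_neutral_right) (simp_all add: vals(6))
    also have "\<dots> = p k l * c k l + c l k"
      using kl diag by (simp add: vals(1-4) mult.commute)
    finally show ?thesis .
  qed
qed


section \<open>Multilinear maps on tensor powers\<close>

lemma linear_add_scale:
  assumes "Vector_Spaces.linear s1 s2 f"
  shows "f (a + b) = f a + f b" and "f (s1 c a) = s2 c (f a)"
  using assms by (auto simp: Vector_Spaces.linear_iff)

text \<open>
  Coproducts are only given up to the subspace \<open>null2\<close> or \<open>null3\<close>. A multilinear map sees no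
  difference, which is how the Hopf algebra axioms become usable equations in an algebra.
\<close>

lemma lin_ext_null2:
  assumes f1: "\<And>b. Vector_Spaces.linear s1 s2 (\<lambda>a. f a b)"
    and f2: "\<And>a. Vector_Spaces.linear s1 s2 (\<lambda>b. f a b)"
    and s: "s \<in> null2 s1"
  shows "lin_ext s2 (\<lambda>(a, b). f a b) s = 0"
proof -
  interpret V: vector_space s2 using f1 by (auto simp: Vector_Spaces.linear_iff)
  have "null2 s1 \<subseteq> {s. lin_ext s2 (\<lambda>(a, b). f a b) s \<in> {0}}"
    unfolding null2_def
    by (intro formal.span_minimal V.subspace_lin_ext_vimage)
      (auto simp: V.lin_ext_diff V.lin_ext_fscale linear_add_scale[OF f1] linear_add_scale[OF f2])
  then show ?thesis using s by auto
qed

lemma lin_ext_tensor2_eq: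
  assumes f1: "\<And>b. Vector_Spaces.linear s1 s2 (\<lambda>a. f a b)"
    and f2: "\<And>a. Vector_Spaces.linear s1 s2 (\<lambda>b. f a b)"
    and eq: "tensor2_eq s1 s t"
  shows "lin_ext s2 (\<lambda>(a, b). f a b) s = lin_ext s2 (\<lambda>(a, b). f a b) t"
proof -
  interpret V: vector_space s2 using f1 by (auto simp: Vector_Spaces.linear_iff)
  show ?thesis
    using lin_ext_null2[OF f1 f2 eq[unfolded tensor2_eq_def]] by (simp add: V.lin_ext_diff)
qed

lemma lin_ext_tensor3_eq:
  assumes f1: "\<And>b c. Vector_Spaces.linear s1 s2 (\<lambda>a. f a b c)"
    and f2: "\<And>a c. Vector_Spaces.linear s1 s2 (\<lambda>b. f a b c)"
    and f3: "\<And>a b. Vector_Spaces.linear s1 s2 (\<lambda>c. f a b c)"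
    and eq: "tensor3_eq s1 s t"
  shows "lin_ext s2 (\<lambda>(a, b, c). f a b c) s = lin_ext s2 (\<lambda>(a, b, c). f a b c) t"
proof -
  interpret V: vector_space s2 using f1 by (auto simp: Vector_Spaces.linear_iff)
  have case2: "(\<lambda>b. lin_ext s2 (\<lambda>(a, b, c). f a b c) (case b of (a, b) \<Rightarrow> h a b)) =
      (\<lambda>(a, b). lin_ext s2 (\<lambda>(a, b, c). f a b c) (h a b))" for h :: "'a \<Rightarrow> 'a \<Rightarrow> _"
    by auto
  have "null3 s1 \<subseteq> {s. lin_ext s2 (\<lambda>(a, b, c). f a b c) s \<in> {0}}"
    unfolding null3_def
  proof (intro formal.span_minimal V.subspace_lin_ext_vimage V.subspace_single_0 Un_least subsetI)
    fix r :: "'a \<times> 'a \<times> 'a \<Rightarrow>\<^sub>0 'b"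
    assume "r \<in> {lin_ext fscale (\<lambda>(a, b). pure3 a b c) s | c s. s \<in> null2 s1}"
    then obtain c s where "r = lin_ext fscale (\<lambda>(a, b). pure3 a b c) s" "s \<in> null2 s1" by blast
    then show "r \<in> {s. lin_ext s2 (\<lambda>(a, b, c). f a b c) s \<in> {0}}"
      using lin_ext_null2[OF f1 f2, of s c] by (simp add: V.lin_ext_lin_ext case2)
  next
    fix r :: "'a \<times> 'a \<times> 'a \<Rightarrow>\<^sub>0 'b"
    assume "r \<in> {lin_ext fscale (\<lambda>(b, c). pure3 a b c) s | a s. s \<in> null2 s1}"
    then obtain a s where "r = lin_ext fscale (\<lambda>(b, c). pure3 a b c) s" "s \<in> null2 s1" by blast
    then show "r \<in> {s. lin_ext s2 (\<lambda>(a, b, c). f a b c) s \<in> {0}}"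
      using lin_ext_null2[OF f2 f3, of s a] by (simp add: V.lin_ext_lin_ext case2)
  qed
  moreover have "s - t \<in> null3 s1" using eq by (simp add: tensor3_eq_def)
  ultimately show ?thesis by (auto simp: V.lin_ext_diff)
qed

text \<open>
  The multiplication of the tensor square is well defined in its left argument. The map
  \<open>(a, b) \<mapsto> pure2 (a * c) (b * d)\<close> is bilinear only modulo \<open>null2\<close>, so this does not follow from
  the previous facts; instead the generators of \<open>null2\<close> are multiplied out one family at a time.
\<close>

lemma tensor2_mult_null2:
  fixes scale :: "'k::field \<Rightarrow> 'h::ring_1 \<Rightarrow> 'h"
  assumes "k_algebra scale" and s: "s \<in> null2 scale"
  shows "tensor2_mult s t \<in> null2 scale"
proof -
  interpret k_algebra scale by fact
  let ?\<phi> = "\<lambda>(a, b). lin_ext fscale (\<lambda>(c, d). pure2 (a * c) (b * d)) t"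
  have sub: "formal.subspace (null2 scale)" by (simp add: null2_def formal.subspace_span)
  have "null2 scale \<subseteq> {s. lin_ext fscale ?\<phi> s \<in> null2 scale}"
  proof -
    have 1: "pure2 (a + a') b - pure2 a b - pure2 a' b \<in> null2 scale" for a a' b
      unfolding null2_def by (rule formal.span_base) blast
    have 2: "pure2 a (b + b') - pure2 a b - pure2 a b' \<in> null2 scale" for a b b'
      unfolding null2_def by (rule formal.span_base) blast
    have 3: "pure2 (scale c a) b - fscale c (pure2 a b) \<in> null2 scale" for c a b
      unfolding null2_def by (rule formal.span_base) blast
    have 4: "pure2 a (scale c b) - fscale c (pure2 a b) \<in> null2 scale" for c a b
      unfolding null2_def by (rule formal.span_base) blast
    have 5: "lin_ext fscale ?\<phi> (pure2 (a + a') b - pure2 a b - pure2 a' b) =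
        lin_ext fscale (\<lambda>(c, d). pure2 (a * c + a' * c) (b * d) - pure2 (a * c) (b * d)
          - pure2 (a' * c) (b * d)) t" for a a' b
      by (simp add: formal.lin_ext_diff case_prod_unfold distrib_right
          flip: formal.lin_ext_diff_fun)
    have 6: "lin_ext fscale ?\<phi> (pure2 a (b + b') - pure2 a b - pure2 a b') =
        lin_ext fscale (\<lambda>(c, d). pure2 (a * c) (b * d + b' * d) - pure2 (a * c) (b * d)
          - pure2 (a * c) (b' * d)) t" for a b b'
      by (simp add: formal.lin_ext_diff case_prod_unfold distrib_right
          flip: formal.lin_ext_diff_fun)
    have 7: "lin_ext fscale ?\<phi> (pure2 (scale e a) b - fscale e (pure2 a b)) =
        lin_ext fscale (\<lambda>(c, d). pure2 (scale e (a * c)) (b * d)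
          - fscale e (pure2 (a * c) (b * d))) t" for e a b
      by (simp add: formal.lin_ext_diff formal.lin_ext_fscale case_prod_unfold scale_mult_left
          flip: formal.lin_ext_diff_fun formal.lin_ext_scale_fun)
    have 8: "lin_ext fscale ?\<phi> (pure2 a (scale e b) - fscale e (pure2 a b)) =
        lin_ext fscale (\<lambda>(c, d). pure2 (a * c) (scale e (b * d))
          - fscale e (pure2 (a * c) (b * d))) t" for e a b
      by (simp add: formal.lin_ext_diff formal.lin_ext_fscale case_prod_unfold scale_mult_left
          flip: formal.lin_ext_diff_fun formal.lin_ext_scale_fun)
    have gens: "formal.span G \<subseteq> {s. lin_ext fscale ?\<phi> s \<in> null2 scale}"
      if "\<And>s. s \<in> G \<Longrightarrow> lin_ext fscale ?\<phi> s \<in> null2 scale" for G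
      using that by (intro formal.span_minimal formal.subspace_lin_ext_vimage sub) auto
    show ?thesis
      by (subst (1) null2_def, rule gens, elim UnE; clarify; unfold 5 6 7 8;
          rule formal.lin_ext_mem[OF sub]; clarify; rule 1 2 3 4)
  qed
  then show ?thesis using s by (auto simp: tensor2_mult_def)
qed


section \<open>The ideal generated by a normal skew-primitive element\<close>

context hopf_algebra
begin

lemma comult_mult_left:
  assumes "tensor2_eq scale (\<Delta> a) s"
  shows "tensor2_eq scale (\<Delta> (a * b)) (tensor2_mult s (\<Delta> b))"
proof -
  have sub: "formal.subspace (null2 scale)" by (simp add: null2_def formal.subspace_span)
  have "tensor2_mult (\<Delta> a - s) (\<Delta> b) \<in> null2 scale"
    using assms by (intro tensor2_mult_null2 k_algebra_axioms) (simp add: tensor2_eq_def)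
  then have "tensor2_mult (\<Delta> a) (\<Delta> b) - tensor2_mult s (\<Delta> b) \<in> null2 scale"
    by (simp add: tensor2_mult_def formal.lin_ext_diff)
  from formal.subspace_add[OF sub comult_mult[of a b, unfolded tensor2_eq_def] this]
  show ?thesis by (simp add: tensor2_eq_def)
qed

lemma linear_endoI:
  assumes "\<And>a b. f (a + b) = f a + f b" "\<And>c a. f (scale c a) = scale c (f a)"
  shows "Vector_Spaces.linear scale scale f"
  using assms by (simp add: Vector_Spaces.linear_iff vector_space_axioms)

definition skew_primitive :: "'h \<Rightarrow> 'h \<Rightarrow> bool" where
  "skew_primitive g x \<longleftrightarrow> tensor2_eq scale (\<Delta> x) (pure2 g x + pure2 x 1)"

text \<open>
  Applying \<open>\<epsilon> \<otimes> id\<close> to \<open>g \<otimes> x + x \<otimes> 1\<close> gives \<open>x + \<epsilon> x \<cdot> 1\<close>, which the counit axiom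
  identifies with \<open>x\<close>.
\<close>

lemma counit_skew_primitive:
  assumes "grouplike g" "skew_primitive g x"
  shows "\<epsilon> x = 0"
proof -
  have "lin_ext scale (\<lambda>(a, b). scale (\<epsilon> a) b) (\<Delta> x) =
      lin_ext scale (\<lambda>(a, b). scale (\<epsilon> a) b) (pure2 g x + pure2 x 1)"
    by (rule lin_ext_tensor2_eq[OF linear_endoI linear_endoI assms(2)[unfolded skew_primitive_def]])
      (simp_all add: counit_add counit_scale scale_left_distrib scale_right_distrib mult.commute)
  then have "x = x + scale (\<epsilon> x) 1"
    using assms(1) by (simp add: counit_left lin_ext_add grouplike_def)
  then have "scale (\<epsilon> x) 1 = 0" by simp
  then have "\<epsilon> (scale (\<epsilon> x) 1) = \<epsilon> (scale 0 1)" by simp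
  then show ?thesis by (simp only: counit_scale counit_one) simp
qed

lemma comult_skew_primitive_mult:
  assumes "skew_primitive g x"
  shows "tensor2_eq scale (\<Delta> (x * h))
    (lin_ext fscale (\<lambda>(a, b). pure2 (g * a) (x * b) + pure2 (x * a) b) (\<Delta> h))"
proof -
  have "tensor2_mult (pure2 g x + pure2 x 1) (\<Delta> h) =
      lin_ext fscale (\<lambda>(a, b). pure2 (g * a) (x * b) + pure2 (x * a) b) (\<Delta> h)"
    by (simp add: tensor2_mult_def formal.lin_ext_add case_prod_unfold
        flip: formal.lin_ext_plus_fun)
  then show ?thesis
    using comult_mult_left[OF assms[unfolded skew_primitive_def]] by metis
qed

text \<open>
  The right ideal \<open>x H\<close> is two-sided because \<open>x\<close> is normal, and
  \<open>\<Delta> (x h) = g h\<^sub>1 \<otimes> x h\<^sub>2 + x h\<^sub>1 \<otimes> h\<^sub>2\<close> shows that it is a coideal. Stability under the antipode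
  is the delicate point, because antimultiplicativity of \<open>S\<close> is not among the axioms. The antipode
  axiom for \<open>x h\<close> reads \<open>S (g h\<^sub>1) x h\<^sub>2 + S (x h\<^sub>1) h\<^sub>2 = 0\<close>, so \<open>S (x h\<^sub>1) h\<^sub>2\<close> lies in the ideal
  for every \<open>h\<close>. By coassociativity \<open>S (x h\<^sub>1) h\<^sub>2 S h\<^sub>3\<close> then lies in the ideal as well, and this
  is \<open>S (x h)\<close>.
\<close>

lemma hopf_ideal_of_normal_skew_primitive:
  assumes g: "grouplike g" and x: "skew_primitive g x"
    and normal: "\<And>r. \<exists>s. r * x = x * s"
  shows "hopf_ideal (range ((*) x))"
proof -
  let ?I = "range ((*) x)"
  have subI: "subspace ?I"
    unfolding subspace_def
    by (auto simp: image_iff scale_mult_right simp flip: distrib_left intro: exI[of _ 0])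
  have left: "r * (x * h) \<in> ?I" for r h
    using normal[of r] by (metis mult.assoc rangeI)
  have right: "a * r \<in> ?I" if "a \<in> ?I" for a r
    using that by (auto simp: mult.assoc)
  have ideal: "two_sided_ideal ?I"
    unfolding two_sided_ideal_def
    using left right subspace_0[OF subI] subspace_add[OF subI] by blast
  have eps: "\<epsilon> (x * h) = 0" for h
    by (simp add: counit_mult counit_skew_primitive[OF g x])

  let ?J = "{pure2 a b | a b. a \<in> ?I \<or> b \<in> ?I} \<union> null2 scale"
  have comult: "\<Delta> (x * h) \<in> formal.span ?J" for h
  proof -
    let ?t = "lin_ext fscale (\<lambda>(a, b). pure2 (g * a) (x * b) + pure2 (x * a) b) (\<Delta> h)"
    have "?t \<in> formal.span ?J"
    proof (rule formal.lin_ext_mem[OF formal.subspace_span], clarify)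
      fix a b
      have "pure2 (g * a) (x * b) \<in> ?J" "pure2 (x * a) b \<in> ?J" by blast+
      then show "pure2 (g * a) (x * b) + pure2 (x * a) b \<in> formal.span ?J"
        by (intro formal.span_add formal.span_base)
    qed
    moreover have "\<Delta> (x * h) - ?t \<in> formal.span ?J"
      using comult_skew_primitive_mult[OF x, of h]
      by (intro formal.span_base) (simp add: tensor2_eq_def)
    ultimately show ?thesis using formal.span_add by fastforce
  qed

  have conv: "lin_ext scale (\<lambda>(a, b). S (x * a) * b) (\<Delta> h) \<in> ?I" for h
  proof -
    have "0 = lin_ext scale (\<lambda>(a, b). S a * b) (\<Delta> (x * h))"
      by (simp add: antipode_left eps)
    also have "\<dots> = lin_ext scale (\<lambda>(a, b). S a * b)
        (lin_ext fscale (\<lambda>(a, b). pure2 (g * a) (x * b) + pure2 (x * a) b) (\<Delta> h))"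
      by (rule lin_ext_tensor2_eq[OF linear_endoI linear_endoI comult_skew_primitive_mult[OF x]])
        (simp_all add: antipode_add antipode_scale distrib_left distrib_right
          flip: scale_mult_left scale_mult_right)
    also have "\<dots> = lin_ext scale (\<lambda>(a, b). S (g * a) * (x * b)) (\<Delta> h) +
        lin_ext scale (\<lambda>(a, b). S (x * a) * b) (\<Delta> h)"
      by (simp add: lin_ext_lin_ext lin_ext_add case_prod_unfold flip: lin_ext_plus_fun)
    finally have "lin_ext scale (\<lambda>(a, b). S (x * a) * b) (\<Delta> h) =
        - lin_ext scale (\<lambda>(a, b). S (g * a) * (x * b)) (\<Delta> h)"
      by (metis add.commute add_eq_0_iff)
    moreover have "lin_ext scale (\<lambda>(a, b). S (g * a) * (x * b)) (\<Delta> h) \<in> ?I"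
      using left by (intro lin_ext_mem subI) auto
    ultimately show ?thesis using subspace_neg[OF subI] by metis
  qed

  have antipode: "S (x * h) \<in> ?I" for h
  proof -
    \<comment> \<open>the two sides of coassociativity evaluate to an element of the ideal and to \<open>S (x * h)\<close>\<close>
    let ?T = "\<lambda>(a, b, c). S (x * a) * b * S c"
    have "lin_ext scale ?T
        (lin_ext fscale (\<lambda>(a, c). lin_ext fscale (\<lambda>(a', b). pure3 a' b c) (\<Delta> a)) (\<Delta> h)) =
      lin_ext scale ?T
        (lin_ext fscale (\<lambda>(a, c). lin_ext fscale (\<lambda>(b, c'). pure3 a b c') (\<Delta> c)) (\<Delta> h))"
      by (rule lin_ext_tensor3_eq[OF linear_endoI linear_endoI linear_endoI coassoc])
        (simp_all add: antipode_add antipode_scale distrib_left distrib_right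
          flip: scale_mult_left scale_mult_right)
    moreover have "lin_ext scale ?T
        (lin_ext fscale (\<lambda>(a, c). lin_ext fscale (\<lambda>(a', b). pure3 a' b c) (\<Delta> a)) (\<Delta> h)) =
        lin_ext scale (\<lambda>(a, c). lin_ext scale (\<lambda>(a', b). S (x * a') * b) (\<Delta> a) * S c) (\<Delta> h)"
      by (simp add: lin_ext_lin_ext case_prod_unfold flip: lin_ext_mult_right)
    moreover have "\<dots> \<in> ?I"
      using conv right by (intro lin_ext_mem subI) auto
    moreover have "lin_ext scale ?T
        (lin_ext fscale (\<lambda>(a, c). lin_ext fscale (\<lambda>(b, c'). pure3 a b c') (\<Delta> c)) (\<Delta> h)) = S (x * h)"
    proof -
      have "lin_ext scale (\<lambda>(b, c'). S (x * a) * b * S c') (\<Delta> c) = scale (\<epsilon> c) (S (x * a))" for a c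
      proof -
        have "lin_ext scale (\<lambda>(b, c'). S (x * a) * b * S c') (\<Delta> c) =
            S (x * a) * lin_ext scale (\<lambda>(b, c'). b * S c') (\<Delta> c)"
          by (simp add: lin_ext_mult_left case_prod_unfold mult.assoc)
        then show ?thesis by (simp add: antipode_right flip: scale_mult_right)
      qed
      then have "lin_ext scale ?T
          (lin_ext fscale (\<lambda>(a, c). lin_ext fscale (\<lambda>(b, c'). pure3 a b c') (\<Delta> c)) (\<Delta> h)) =
          lin_ext scale (\<lambda>(a, c). scale (\<epsilon> c) (S (x * a))) (\<Delta> h)"
        by (simp add: lin_ext_lin_ext case_prod_unfold)
      also have "\<dots> = S (x * lin_ext scale (\<lambda>(a, c). scale (\<epsilon> c) a) (\<Delta> h))"
        by (subst linear_lin_ext[of "\<lambda>a. S (x * a)"], rule linear_endoI)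
          (simp_all add: distrib_left antipode_add antipode_scale case_prod_unfold
            flip: scale_mult_right)
      finally show ?thesis by (simp add: counit_right)
    qed
    ultimately show ?thesis by simp
  qed

  show ?thesis
    unfolding hopf_ideal_def using ideal comult eps antipode by auto
qed

end


section \<open>Solving the coefficient equations\<close>

text \<open>
  If \<open>g\<close> sends \<open>u i\<close> to \<open>\<alpha> i u (\<sigma> i)\<close> and \<open>x\<close> sends \<open>u j\<close> to the sum of all \<open>b k j u k\<close>, this is
  the coefficient of \<open>u k * u l\<close> in \<open>x \<cdot> (u i * u j - p i j u j * u i)\<close>, computed from
  \<open>x \<cdot> (a b) = (g \<cdot> a) (x \<cdot> b) + (x \<cdot> a) b\<close>.
\<close>

definition relation_coeff ::
    "('i \<Rightarrow> 'i \<Rightarrow> 'k) \<Rightarrow> ('i \<Rightarrow> 'i) \<Rightarrow> ('i \<Rightarrow> 'k) \<Rightarrow> ('i \<Rightarrow> 'i \<Rightarrow> 'k) \<Rightarrow>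
      'i \<Rightarrow> 'i \<Rightarrow> 'i \<Rightarrow> 'i \<Rightarrow> 'k::field" where
  "relation_coeff p \<sigma> \<alpha> b i j k l =
     of_bool (k = \<sigma> i) * \<alpha> i * b l j + b k i * of_bool (l = j) -
     p i j * (of_bool (k = \<sigma> j) * \<alpha> j * b l i + b k j * of_bool (l = i))"

text \<open>
  The assumption \<open>automorphism\<close> comes from \<open>g\<close> preserving the quantum relations, \<open>relation\<close> from
  \<open>x\<close> preserving them, where the monomials \<open>u k * u l\<close> and \<open>u l * u k\<close> have to be collected, and
  \<open>commutation\<close> from \<open>g x = \<lambda> x g\<close>.
\<close>

locale taft_coefficients =
  fixes p :: "'i \<Rightarrow> 'i \<Rightarrow> 'k::field_char_0" and \<sigma> :: "'i \<Rightarrow> 'i"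
    and \<alpha> :: "'i \<Rightarrow> 'k" and b :: "'i \<Rightarrow> 'i \<Rightarrow> 'k" and lam :: 'k
  assumes p_diag: "p i i = 1" and p_inv: "p i j * p j i = 1"
    and p_square: "i \<noteq> j \<Longrightarrow> p i j * p i j \<noteq> 1"
    and inj: "\<sigma> i = \<sigma> j \<Longrightarrow> i = j"
    and alpha: "\<alpha> i \<noteq> 0"
    and automorphism: "p (\<sigma> i) (\<sigma> j) = p i j"
    and relation: "p k l * relation_coeff p \<sigma> \<alpha> b i j k l + relation_coeff p \<sigma> \<alpha> b i j l k = 0"
    and commutation: "\<alpha> k * b k i = lam * \<alpha> i * b (\<sigma> k) (\<sigma> i)"
    and lam_square: "lam * lam \<noteq> 1"
begin

lemma p_nz: "p i j \<noteq> 0"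
  using p_inv[of i j] by auto

lemma lam_not_1: "lam \<noteq> 1"
  using lam_square by auto

lemma p_not_1: "i \<noteq> j \<Longrightarrow> p i j \<noteq> 1"
  using p_square[of i j] by auto

lemma relation_square: "relation_coeff p \<sigma> \<alpha> b i j k k = 0"
  using relation[of k k i j] by (simp add: p_diag)

text \<open>
  A transposed pair would have \<open>p i j = p j i\<close>, hence \<open>(p i j)\<^sup>2 = 1\<close>.
\<close>

lemma no_transposition:
  assumes "\<sigma> i \<noteq> i" shows "\<sigma> (\<sigma> i) \<noteq> i"
proof
  assume "\<sigma> (\<sigma> i) = i"
  then have "p (\<sigma> i) i = p i (\<sigma> i)" using automorphism[of i "\<sigma> i"] by simp
  then show False using p_square[of i "\<sigma> i"] p_inv[of i "\<sigma> i"] assms by auto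
qed

text \<open>
  The entry \<open>b k j\<close> is isolated by choosing a second index \<open>i\<close> that is moved by \<open>\<sigma>\<close> but not to
  \<open>j\<close>: in the relation for \<open>u i\<close> and \<open>u j\<close> the monomial \<open>u (\<sigma> i) * u k\<close> then has no other
  contribution, unless \<open>k = i\<close>, in which case the square of \<open>u i\<close> plays this part. If \<open>\<sigma>\<close> moves
  \<open>j\<close>, then \<open>i = \<sigma> j\<close> is such an index because \<open>\<sigma>\<close> has no transpositions; otherwise any
  moved index will do.
\<close>

lemma support_if_moved:
  assumes i0: "\<sigma> i0 \<noteq> i0" and k: "k \<noteq> j" "k \<noteq> \<sigma> j"
  shows "b k j = 0"
proof -
  define i where "i = (if \<sigma> j \<noteq> j then \<sigma> j else i0)"
  have i: "i \<noteq> j" "\<sigma> i \<noteq> i" "\<sigma> i \<noteq> j"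
    using no_transposition[of j] inj[of "\<sigma> j" j] inj[of i0 j] i0 by (auto simp: i_def)
  have ij: "\<sigma> i \<noteq> \<sigma> j" using inj i(1) by blast
  show ?thesis
  proof (cases "k = i")
    case True
    then have "\<sigma> j \<noteq> i" using k by auto
    then have "relation_coeff p \<sigma> \<alpha> b i j i i = - p i j * b i j"
      using i by (auto simp: relation_coeff_def)
    then show ?thesis using True p_nz relation_square[of i j i] by auto
  next
    case False
    then have 1: "relation_coeff p \<sigma> \<alpha> b i j (\<sigma> i) k = \<alpha> i * b k j"
      using i ij k by (auto simp: relation_coeff_def)
    show ?thesis
    proof (cases "k = \<sigma> i")
      case True
      then show ?thesis using 1 relation_square[of i j k] alpha[of i] by simp
    next
      case False
      then have "relation_coeff p \<sigma> \<alpha> b i j k (\<sigma> i) = 0"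
        using i k by (auto simp: relation_coeff_def)
      then show ?thesis using 1 relation[of "\<sigma> i" k i j] alpha[of i] p_nz by simp
    qed
  qed
qed

text \<open>
  Commutation gives \<open>b j j = \<lambda> * b (\<sigma> j) (\<sigma> j)\<close>. The coefficient belonging to the pair
  \<open>{j, \<sigma> j}\<close> in the relation for \<open>u (\<sigma> j)\<close> and \<open>u j\<close> says that these two diagonal entries are
  equal, so both vanish as \<open>\<lambda> \<noteq> 1\<close>.
\<close>

lemma diagonal_if_moved:
  assumes i0: "\<sigma> i0 \<noteq> i0" shows "b j j = 0"
proof -
  have comm: "b j j = lam * b (\<sigma> j) (\<sigma> j)"
    using commutation[of j j] alpha[of j] by auto
  show ?thesis
  proof (cases "\<sigma> j = j")
    case True
    then show ?thesis using comm lam_not_1 by auto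
  next
    case False
    define i where "i = \<sigma> j"
    have i: "i \<noteq> j" "\<sigma> i \<noteq> i" "\<sigma> i \<noteq> j"
      using no_transposition[of j] inj[of "\<sigma> j" j] False by (auto simp: i_def)
    have "b j i = 0" using support_if_moved[OF i0, of j i] i by auto
    then have "relation_coeff p \<sigma> \<alpha> b i j i j = b i i"
      using i by (auto simp: relation_coeff_def)
    moreover have "relation_coeff p \<sigma> \<alpha> b i j j i = - p i j * b j j"
      using i False by (auto simp: relation_coeff_def)
    ultimately have "b j j = b i i"
      using relation[of j i i j] p_inv[of j i] by (simp flip: mult.assoc)
    then show ?thesis using comm lam_not_1 by (auto simp: i_def)
  qed
qed

text \<open>
  The entries \<open>b (\<sigma> j) j\<close> are the last ones left. They are killed by the coefficient of the square
  of \<open>u (\<sigma> j)\<close> in the relation for \<open>u (\<sigma> j)\<close> and \<open>u j\<close>.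
\<close>

lemma vanish_if_moved:
  assumes i0: "\<sigma> i0 \<noteq> i0" shows "b k j = 0"
proof -
  have "b (\<sigma> j) j = 0" if "\<sigma> j \<noteq> j"
  proof -
    define i where "i = \<sigma> j"
    have "i \<noteq> j" "\<sigma> i \<noteq> i" using inj[of "\<sigma> j" j] that by (auto simp: i_def)
    then have "relation_coeff p \<sigma> \<alpha> b i j i i = - p i j * b i j"
      using diagonal_if_moved[OF i0] by (auto simp: relation_coeff_def)
    then show ?thesis using relation_square[of i j i] p_nz by (auto simp: i_def)
  qed
  then show ?thesis
    using support_if_moved[OF i0, of k j] diagonal_if_moved[OF i0, of j] by metis
qed

end

text \<open>
  In the diagonal case a nonzero entry \<open>b k j\<close> is regarded as an edge from \<open>j\<close> to \<open>k\<close>; the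
  matrix \<open>b\<close> is determined by this directed graph and its labels.
\<close>

locale diagonal_taft_coefficients = taft_coefficients p id \<alpha> b lam
  for p :: "'i \<Rightarrow> 'i \<Rightarrow> 'k::field_char_0" and \<alpha> b lam
begin

lemma edge_weight: "b k j \<noteq> 0 \<Longrightarrow> \<alpha> k = lam * \<alpha> j"
  using commutation[of k j] by simp

lemma edge_irrefl: "b k j \<noteq> 0 \<Longrightarrow> k \<noteq> j"
  using edge_weight[of j j] lam_not_1 alpha by auto

text \<open>
  One edge determines all eigenvalues of \<open>g\<close>: this is the coefficient belonging to the pair
  \<open>{i, k}\<close> in the relation for \<open>u i\<close> and \<open>u j\<close>. The subsequent restrictions on the graph all come
  from comparing the eigenvalues obtained from two different edges.
\<close>

lemma edge_eigenvalue:
  assumes b: "b k j \<noteq> 0" and i: "i \<noteq> j"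
  shows "\<alpha> i = p i j * p k i"
proof (cases "k = i")
  case True
  have "relation_coeff p id \<alpha> b i j i i = (\<alpha> i - p i j) * b i j"
    using i by (auto simp: relation_coeff_def algebra_simps)
  then show ?thesis using relation_square[of i j i] b True p_diag by auto
next
  case False
  have "relation_coeff p id \<alpha> b i j i k = \<alpha> i * b k j"
    and "relation_coeff p id \<alpha> b i j k i = - p i j * b k j"
    using i False edge_irrefl[OF b] by (auto simp: relation_coeff_def)
  then have "p i k * \<alpha> i = p i j"
    using relation[of i k i j] b by (simp flip: mult.assoc left_diff_distrib)
  have "\<alpha> i = (p k i * p i k) * \<alpha> i" by (simp only: p_inv mult_1)
  also have "\<dots> = p k i * (p i k * \<alpha> i)" by (simp only: mult.assoc)
  also have "\<dots> = p i j * p k i" using \<open>p i k * \<alpha> i = p i j\<close> by (simp only: mult.commute)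
  finally show ?thesis .
qed

lemma edge_eigenvalue_target: "b k j \<noteq> 0 \<Longrightarrow> \<alpha> k = p k j"
  using edge_eigenvalue[of k j k] edge_irrefl by (simp add: p_diag)

lemma edge_target_unique:
  assumes "b k j \<noteq> 0" "b l j \<noteq> 0" shows "k = l"
proof (rule ccontr)
  assume "k \<noteq> l"
  have "p k j = p k j * p l k"
    using edge_eigenvalue[OF assms(2), of k] edge_eigenvalue_target edge_irrefl assms(1) by metis
  then show False using p_nz p_not_1[of l k] \<open>k \<noteq> l\<close> by auto
qed

lemma edge_source_unique:
  assumes "b k j \<noteq> 0" "b k l \<noteq> 0" shows "j = l"
proof (rule ccontr)
  assume "j \<noteq> l"
  have 1: "p k j = p k l" using assms edge_eigenvalue_target by metis
  have "lam * \<alpha> j = lam * \<alpha> l" using assms edge_weight by metis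
  moreover have "lam \<noteq> 0" using edge_weight assms(1) alpha[of k] by auto
  ultimately have "p j l * p k j = p l j * p k l"
    using edge_eigenvalue[OF assms(1), of l] edge_eigenvalue[OF assms(2), of j] \<open>j \<noteq> l\<close> by auto
  then have "p j l = p l j" using 1 p_nz by auto
  then show False using p_square[of j l] p_inv[of j l] \<open>j \<noteq> l\<close> by auto
qed

text \<open>
  For two disjoint edges the products \<open>\<alpha> i * \<alpha> k\<close> of the eigenvalues at the targets and
  \<open>\<alpha> j * \<alpha> l\<close> at the sources, each computed by means of the respective other edge, both equal
  \<open>p i l * p k j\<close>. They also differ by the factor \<open>\<lambda>\<^sup>2 \<noteq> 1\<close>.
\<close>

lemma edges_not_disjoint:
  assumes e: "b i j \<noteq> 0" and f: "b k l \<noteq> 0" and ne: "i \<noteq> k" "i \<noteq> l" "j \<noteq> k" "j \<noteq> l"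
  shows False
proof -
  have "\<alpha> i * \<alpha> k = (p i l * p k i) * (p k j * p i k)"
    using edge_eigenvalue[OF e, of k] edge_eigenvalue[OF f, of i] ne by simp
  also have "\<dots> = (p i l * p k j) * (p k i * p i k)" by (simp only: mult_ac)
  also have "\<dots> = (p i l * p k j) * (p j l * p l j)" by (simp only: p_inv)
  also have "\<dots> = (p j l * p k j) * (p l j * p i l)" by (simp only: mult_ac)
  also have "\<dots> = \<alpha> j * \<alpha> l"
    using edge_eigenvalue[OF e, of l] edge_eigenvalue[OF f, of j] ne by simp
  finally have "lam * lam * (\<alpha> j * \<alpha> l) = \<alpha> j * \<alpha> l"
    using edge_weight[OF e] edge_weight[OF f] by (simp add: mult_ac)
  then show False using lam_square alpha by auto
qed

lemma no_two_cycle: "b i j \<noteq> 0 \<Longrightarrow> b j i = 0"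
  using edge_weight[of i j] edge_weight[of j i] lam_square alpha[of i]
  by (auto simp flip: mult.assoc)

lemma edges_adjacent:
  assumes "b i j \<noteq> 0" "b k l \<noteq> 0"
  shows "i = k \<and> j = l \<or> j = k \<and> i \<noteq> l \<or> i = l \<and> j \<noteq> k"
  using assms edges_not_disjoint[OF assms] edge_target_unique edge_source_unique no_two_cycle
  by metis

text \<open>
  In a graph with in-degrees and out-degrees at most one in which any two edges meet, a path of two
  edges can only be prolonged by closing it to a triangle. A triangle is a possible outcome, since for
  suitable \<open>p\<close> and \<open>\<lambda>\<close> of order three it satisfies all the coefficient equations.
\<close>

lemma edges_cases:
  obtains
    (zero) "\<And>k l. b k l = 0"
  | (single) i j where "b i j \<noteq> 0" "\<And>k l. b k l \<noteq> 0 \<Longrightarrow> k = i \<and> l = j"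
  | (path) i j k where "distinct [i, j, k]" "b i j \<noteq> 0" "b j k \<noteq> 0"
      "\<And>l l'. b l l' \<noteq> 0 \<Longrightarrow> l = i \<and> l' = j \<or> l = j \<and> l' = k"
  | (cycle) i j k where "b i j \<noteq> 0" "b j k \<noteq> 0" "b k i \<noteq> 0"
proof -
  consider "\<forall>k l. b k l = 0" | i j where "b i j \<noteq> 0" "\<forall>k l. b k l \<noteq> 0 \<longrightarrow> k = i \<and> l = j"
    | i j k l where "b i j \<noteq> 0" "b k l \<noteq> 0" "\<not> (k = i \<and> l = j)" by metis
  then show thesis
  proof cases
    case 1 then show ?thesis using zero by blast
  next
    case 2 then show ?thesis using single by blast
  next
    case 3
    then obtain i j k where path: "b i j \<noteq> 0" "b j k \<noteq> 0" "i \<noteq> k"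
      using edges_adjacent by metis
    then have d: "distinct [i, j, k]" using edge_irrefl by auto
    show ?thesis
    proof (cases "b k i = 0")
      case True
      have "l = i \<and> l' = j \<or> l = j \<and> l' = k" if "b l l' \<noteq> 0" for l l'
        using edges_adjacent[OF that path(1)] edges_adjacent[OF that path(2)]
          edge_irrefl[OF that] True that d by auto
      then show ?thesis using that(3) d path by blast
    next
      case False
      then show ?thesis using that(4) path by blast
    qed
  qed
qed

end


section \<open>Linear actions on a quantum affine space\<close>

lemma mult_ord_ge_3D:
  assumes "mult_ord z \<ge> 3" shows "z \<noteq> 1" and "z * z \<noteq> 1"
proof -
  have "mult_ord z \<le> k" if "0 < k" "z ^ k = 1" for k
    using that unfolding mult_ord_def by (intro Least_le) simp
  from this[of 1] this[of 2] assms show "z \<noteq> 1" "z * z \<noteq> 1"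
    by (auto simp: power2_eq_square)
qed

lemma primitive_root_of_unity_power:
  assumes "primitive_root_of_unity m z" shows "0 < m" and "z ^ m = 1"
proof -
  have "\<exists>k. 0 < k \<and> z ^ k = 1" and m: "m = mult_ord z"
    using assms by (auto simp: primitive_root_of_unity_def root_of_unity_def)
  from LeastI_ex[OF this(1)] show "0 < m" "z ^ m = 1" by (auto simp: m mult_ord_def)
qed

lemma triangular3_diagonal_power: "Tri a 0 0 d 0 f ^ k = Tri (a ^ k) 0 0 (d ^ k) 0 (f ^ k)"
  by (induction k) (simp_all add: triangular3_defs)

text \<open>
  The matrices \<open>diag(\<lambda>, 1, 1)\<close> and \<open>E\<^sub>1\<^sub>2\<close> satisfy the relations of \<open>g\<close> and \<open>x\<close>.
\<close>

lemma generalized_taft_x_nonzero: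
  fixes scale :: "'k::field \<Rightarrow> 'h::ring_1 \<Rightarrow> 'h"
  assumes T: "generalized_taft n lam m scale \<Delta> \<epsilon> S g x" and m: "2 \<le> m"
  shows "x \<noteq> 0"
proof
  assume "x = 0"
  interpret T: k_algebra "scale_triangular3 :: 'k \<Rightarrow> _" by (rule k_algebra_triangular3)
  let ?R = "{Gen Taft_g ^ n - 1, Gen Taft_x ^ m,
    Gen Taft_g * Gen Taft_x - Const lam * Gen Taft_x * Gen Taft_g}"
  let ?v = "case_taft_gen (Tri lam 0 0 1 0 1) (Tri 0 1 0 0 0 0)"
  have P: "presented_algebra scale (case_taft_gen g x) ?R"
    using T unfolding generalized_taft_def by blast
  then interpret k_algebra scale by (simp add: presented_algebra_def)
  have "m dvd n" "lam ^ m = 1"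
    using T primitive_root_of_unity_power(2) unfolding generalized_taft_def by blast+
  then have "lam ^ n = 1" by (auto simp: power_mult)
  then have "free_eval scale_triangular3 ?v (Gen Taft_g ^ n - 1) = 0"
    by (simp add: T.free_eval_simps triangular3_diagonal_power) (simp add: triangular3_defs)
  moreover have "(Tri 0 1 0 0 0 0 :: 'k triangular3) ^ m = 0"
  proof -
    obtain k where "m = 2 + k" using m le_Suc_ex by blast
    then show ?thesis by (simp add: power_add power2_eq_square) (simp add: triangular3_defs)
  qed
  then have "free_eval scale_triangular3 ?v (Gen Taft_x ^ m) = 0"
    by (simp add: T.free_eval_simps)
  moreover have "free_eval scale_triangular3 ?v
      (Gen Taft_g * Gen Taft_x - Const lam * Gen Taft_x * Gen Taft_g) = 0"
    by (simp add: T.free_eval_simps scale_triangular3_def triangular3_defs)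
  ultimately have "free_eval scale_triangular3 ?v r = 0" if "r \<in> ?R" for r
    using that by auto
  from presented_algebra_universal[OF P k_algebra_triangular3 this]
  have "free_eval scale_triangular3 ?v (Gen Taft_x) = 0"
    using \<open>x = 0\<close> by (simp add: free_eval_Gen)
  then show False by (simp add: T.free_eval_Gen zero_triangular3_def)
qed

lemma subalgebra_generated: "subalgebra scale (generated_subalgebra scale u I)"
  if "k_algebra scale"
proof -
  interpret k_algebra scale by fact
  show ?thesis
    unfolding generated_subalgebra_def
    by (rule hull_in) (auto simp: subalgebra_def subspace_def)
qed

context module_algebra
begin

lemma act_zero_left [simp]: "act 0 a = 0"
  using act_scale_left[of 0 0 a] by simp

lemma act_zero_right [simp]: "act h 0 = 0"
  using act_scale_right[of h 0 0] by simp

lemma act_sum_right: "act h (\<Sum>i\<in>I. f i) = (\<Sum>i\<in>I. act h (f i))"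
  by (induction I rule: infinite_finite_induct) (auto simp: act_add_right)

lemma act_mult_tensor2_eq:
  assumes "tensor2_eq scaleH (\<Delta> h) t"
  shows "act h (a * b) = lin_ext scaleA (\<lambda>(h\<^sub>1, h\<^sub>2). act h\<^sub>1 a * act h\<^sub>2 b) t"
  unfolding act_mult_right
  by (rule lin_ext_tensor2_eq[OF _ _ assms])
    (simp_all add: Vector_Spaces.linear_iff H.vector_space_axioms A.vector_space_axioms
      act_add_left act_scale_left distrib_left distrib_right A.scale_mult_left
      flip: A.scale_mult_right)

lemma act_grouplike_mult: "H.grouplike g \<Longrightarrow> act g (a * b) = act g a * act g b"
  by (subst act_mult_tensor2_eq[of g "pure2 g g"]) (auto simp: H.grouplike_def)

lemma act_skew_primitive_mult:
  "H.skew_primitive g x \<Longrightarrow> act x (a * b) = act g a * act x b + act x a * b"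
  by (subst act_mult_tensor2_eq[of x "pure2 g x + pure2 x 1"])
    (auto simp: H.skew_primitive_def A.lin_ext_add act_one_left)

end

locale linear_taft_action = module_algebra scaleH \<Delta> \<epsilon> S scaleA act
  for scaleH :: "'k::field_char_0 \<Rightarrow> 'h::ring_1 \<Rightarrow> 'h"
    and \<Delta> :: "'h \<Rightarrow> ('h \<times> 'h \<Rightarrow>\<^sub>0 'k)"
    and \<epsilon> :: "'h \<Rightarrow> 'k"
    and S :: "'h \<Rightarrow> 'h"
    and scaleA :: "'k \<Rightarrow> 'a::ring_1 \<Rightarrow> 'a"
    and act :: "'h \<Rightarrow> 'a \<Rightarrow> 'a" +
  fixes n m :: nat and lam :: 'k and g x :: 'h
    and p :: "'i::finite \<Rightarrow> 'i \<Rightarrow> 'k" and u :: "'i \<Rightarrow> 'a"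
  assumes taft: "generalized_taft n lam m scaleH \<Delta> \<epsilon> S g x"
    and space: "quantum_affine_space p scaleA u"
    and faithful: inner_faithful
    and linear_act: "linear_action scaleA u act g x"
    and m_ge: "m \<ge> 3"
    and ord_ge: "i \<noteq> j \<Longrightarrow> mult_ord (p i j) \<ge> 3"
begin

lemma parameters: "p i i = 1" "p i j * p j i = 1"
  using space unfolding quantum_affine_space_def quantum_parameters_def
  by (blast, metis left_inverse)

lemma presentation_H: "presented_algebra scaleH (case_taft_gen g x)
    {Gen Taft_g ^ n - 1, Gen Taft_x ^ m,
     Gen Taft_g * Gen Taft_x - Const lam * Gen Taft_x * Gen Taft_g}"
  using taft unfolding generalized_taft_def by blast

lemma presentation_A:
  "presented_algebra scaleA u {Gen i * Gen j - Const (p i j) * Gen j * Gen i | i j. True}"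
  using space unfolding quantum_affine_space_def by blast

lemma grouplike_g: "H.grouplike g" and skew_x: "H.skew_primitive g x"
  using taft unfolding generalized_taft_def H.skew_primitive_def by blast+

lemma taft_relations: "g ^ n = 1" "x ^ m = 0" "g * x = scaleH lam (x * g)"
proof -
  note rel = presented_algebra_relation[OF presentation_H]
  show "g ^ n = 1" "x ^ m = 0"
    using rel[of "Gen Taft_g ^ n - 1"] rel[of "Gen Taft_x ^ m"]
    by (simp_all add: H.free_eval_simps)
  show "g * x = scaleH lam (x * g)"
    using rel[of "Gen Taft_g * Gen Taft_x - Const lam * Gen Taft_x * Gen Taft_g"]
    by (simp add: H.free_eval_simps H.scale_one_mult flip: H.scale_mult_left)
qed

lemma quantum_relation: "u i * u j = scaleA (p i j) (u j * u i)"
  using presented_algebra_relation[OF presentation_A,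
      of "Gen i * Gen j - Const (p i j) * Gen j * Gen i"]
  by (auto simp: A.free_eval_simps A.scale_one_mult simp flip: A.scale_mult_left)

lemma subalgebra_H_eq_UNIV: "subalgebra scaleH B \<Longrightarrow> g \<in> B \<Longrightarrow> x \<in> B \<Longrightarrow> B = UNIV"
  by (rule presented_algebra_eq_UNIV[OF presentation_H]) (auto split: taft_gen.split)

lemma act_g_one: "act g 1 = 1" and act_x_one: "act x 1 = 0"
  using grouplike_g H.counit_skew_primitive[OF grouplike_g skew_x]
  by (simp_all add: act_one_right H.grouplike_def)

text \<open>
  If \<open>x\<close> annihilated all generators, it would annihilate \<open>A\<close>, and so would the ideal \<open>x H\<close>. This is
  a Hopf ideal because \<open>x\<close> is normal, and it is nonzero, contradicting inner faithfulness.
\<close>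

lemma act_x_nonzero: "\<exists>i. act x (u i) \<noteq> 0"
proof (rule ccontr)
  assume "\<nexists>i. act x (u i) \<noteq> 0"
  then have "{a. act x a = 0} = UNIV"
    by (intro presented_algebra_eq_UNIV[OF presentation_A])
      (auto simp: subalgebra_def A.subspace_def act_add_right act_scale_right act_x_one
        act_skew_primitive_mult[OF skew_x])
  then have act_x: "act x a = 0" for a by blast
  have "{r. \<exists>s. r * x = x * s} = UNIV"
  proof (rule subalgebra_H_eq_UNIV)
    show "subalgebra scaleH {r. \<exists>s. r * x = x * s}"
      unfolding subalgebra_def H.subspace_def mem_Collect_eq ball_simps
    proof (intro conjI allI impI; (elim exE)?)
      show "\<exists>s. 0 * x = x * s" by (rule exI[of _ 0]) simp
      show "\<exists>s. 1 * x = x * s" by (rule exI[of _ 1]) simp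
      show "\<exists>s. (a + b) * x = x * s" if "a * x = x * s" "b * x = x * t" for a b s t
        using that by (intro exI[of _ "s + t"]) (simp add: distrib_left distrib_right)
      show "\<exists>s. scaleH c a * x = x * s" if "a * x = x * s" for c a s
        using that by (intro exI[of _ "scaleH c s"])
          (simp flip: H.scale_mult_left H.scale_mult_right)
      show "\<exists>s. (a * b) * x = x * s" if "a * x = x * s" "b * x = x * t" for a b s t
        using that by (intro exI[of _ "s * t"]) (metis mult.assoc)
    qed
    show "g \<in> {r. \<exists>s. r * x = x * s}"
      using taft_relations(3) by (auto simp: H.scale_mult_right)
  qed auto
  then have "H.hopf_ideal (range ((*) x))"
    by (intro H.hopf_ideal_of_normal_skew_primitive[OF grouplike_g skew_x]) blast
  moreover have "act (x * h) a = 0" for h a by (simp add: act_mult_left act_x)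
  ultimately have "range ((*) x) = {0}"
    using faithful unfolding inner_faithful_def by blast
  then have "x * 1 = 0" by blast
  then show False using generalized_taft_x_nonzero[OF taft] m_ge by simp
qed

lemma generator_sum: "u i = (\<Sum>k\<in>UNIV. scaleA (of_bool (k = i)) (u k))"
  by (simp add: of_bool_def if_distrib[of "\<lambda>c. scaleA c _"] cong: if_cong)

lemma linear_coefficients:
  assumes "act h ` A.span (range u) \<subseteq> A.span (range u)"
  shows "\<exists>c. \<forall>j. act h (u j) = (\<Sum>k\<in>UNIV. scaleA (c k j) (u k))"
proof -
  let ?W = "{a. \<exists>c. a = (\<Sum>k\<in>UNIV. scaleA (c k) (u k))}"
  have "A.span (range u) \<subseteq> ?W"
  proof (rule A.span_minimal)
    show "range u \<subseteq> ?W"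
    proof clarify
      fix i
      show "\<exists>c. u i = (\<Sum>k\<in>UNIV. scaleA (c k) (u k))"
        by (rule exI[of _ "\<lambda>k. of_bool (k = i)"], rule generator_sum)
    qed
    show "A.subspace ?W"
      unfolding A.subspace_def mem_Collect_eq ball_simps
    proof (intro conjI allI impI; (elim exE)?)
      show "\<exists>c. 0 = (\<Sum>k\<in>UNIV. scaleA (c k) (u k))" by (rule exI[of _ "\<lambda>_. 0"]) simp
      show "\<exists>c. a + b = (\<Sum>k\<in>UNIV. scaleA (c k) (u k))"
        if "a = (\<Sum>k\<in>UNIV. scaleA (c k) (u k))" "b = (\<Sum>k\<in>UNIV. scaleA (d k) (u k))" for a b c d
        using that
        by (intro exI[of _ "\<lambda>k. c k + d k"]) (simp add: A.scale_left_distrib sum.distrib)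
      show "\<exists>d. scaleA r a = (\<Sum>k\<in>UNIV. scaleA (d k) (u k))"
        if "a = (\<Sum>k\<in>UNIV. scaleA (c k) (u k))" for r a c
        using that by (intro exI[of _ "\<lambda>k. r * c k"]) (simp add: A.scale_sum_right)
    qed
  qed
  moreover have "act h (u j) \<in> A.span (range u)" for j
    using subsetD[OF assms imageI, OF A.span_base, OF rangeI] .
  ultimately have "act h (u j) \<in> ?W" for j by (rule subsetD)
  then have "\<forall>j. \<exists>c. act h (u j) = (\<Sum>k\<in>UNIV. scaleA (c k) (u k))" by simp
  from choice[OF this] obtain c where "\<forall>j. act h (u j) = (\<Sum>k\<in>UNIV. scaleA (c j k) (u k))" ..
  then show ?thesis by (intro exI[of _ "\<lambda>k j. c j k"])
qed

lemma sum_mult_sum: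
  "(\<Sum>k\<in>UNIV. scaleA (c k) (u k)) * (\<Sum>l\<in>UNIV. scaleA (d l) (u l)) =
    (\<Sum>k\<in>UNIV. \<Sum>l\<in>UNIV. scaleA (c k * d l) (u k * u l))"
  by (simp add: sum_product A.scale_mult_scale)

lemma linear_independent:
  "(\<Sum>k\<in>UNIV. scaleA (c k) (u k)) = (\<Sum>k\<in>UNIV. scaleA (d k) (u k)) \<Longrightarrow> c k = d k"
  using quantum_affine_space_linear_independent[OF space, of "\<lambda>k. c k - d k"]
  by (simp add: A.scale_left_diff_distrib sum_subtractf)

lemma generator_nonzero: "u i \<noteq> 0"
proof
  assume "u i = 0"
  then have "(\<Sum>k\<in>UNIV. scaleA (of_bool (k = i)) (u k)) = (\<Sum>k\<in>UNIV. scaleA 0 (u k))"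
    using generator_sum[of i] by simp
  from linear_independent[OF this, of i] show False by simp
qed

lemma act_g_cancel: "act g a = 0 \<Longrightarrow> a = 0"
proof -
  assume a: "act g a = 0"
  have "0 < n" using taft by (simp add: generalized_taft_def)
  then have "g ^ (n - 1) * g = 1"
    using taft_relations(1) power_minus_mult[of n g] by simp
  then have "act (g ^ (n - 1) * g) a = a" by (simp add: act_one_left)
  then show "a = 0" using a by (simp add: act_mult_left)
qed

lemma p_not_1: "i \<noteq> j \<Longrightarrow> p i j \<noteq> 1"
  using mult_ord_ge_3D ord_ge by blast

text \<open>
  The coefficient of the square of \<open>u k\<close> in \<open>g \<cdot> (u i * u j - p i j u j * u i) = 0\<close> is
  \<open>(1 - p i j) * a k i * a k j\<close>, where \<open>a\<close> is the matrix of \<open>g\<close>. So every row of \<open>a\<close> has at most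
  one nonzero entry, and an invertible matrix with this property is monomial.
\<close>

lemma act_g_monomial:
  obtains \<sigma> \<alpha> where "inj \<sigma>" "\<And>i. \<alpha> i \<noteq> 0" "\<And>i. act g (u i) = scaleA (\<alpha> i) (u (\<sigma> i))"
    "\<And>i j. p (\<sigma> i) (\<sigma> j) = p i j"
proof -
  obtain a where a: "act g (u j) = (\<Sum>k\<in>UNIV. scaleA (a k j) (u k))" for j
    using linear_coefficients[of g] linear_act by (auto simp: linear_action_def)
  have quad: "(\<Sum>k\<in>UNIV. \<Sum>l\<in>UNIV.
      scaleA (a k i * a l j - p i j * (a k j * a l i)) (u k * u l)) = 0" for i j
  proof -
    have "act g (u i * u j) = act g (scaleA (p i j) (u j * u i))"
      by (simp only: quantum_relation[of i j])
    then show ?thesis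
      by (simp add: act_grouplike_mult[OF grouplike_g] act_scale_right a sum_mult_sum
          A.scale_sum_right A.scale_left_diff_distrib sum_subtractf)
  qed
  have row: "a k i = 0 \<or> a k j = 0" if "i \<noteq> j" for k i j
    using quantum_affine_space_quadratic(1)[OF space quad[of i j], of k] p_not_1[OF that]
    by (simp add: mult.commute[of "a k j"])
  have "\<exists>k. a k i \<noteq> 0" for i
  proof (rule ccontr)
    assume "\<nexists>k. a k i \<noteq> 0"
    then have "act g (u i) = 0" by (simp add: a)
    then show False using act_g_cancel generator_nonzero by blast
  qed
  then obtain \<sigma> where \<sigma>: "a (\<sigma> i) i \<noteq> 0" for i by metis
  have inj: "inj \<sigma>" using row \<sigma> by (metis injI)
  then have "surj \<sigma>" by (simp add: finite_UNIV_inj_surj)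
  then have col: "a k i = of_bool (k = \<sigma> i) * a (\<sigma> i) i" for k i
    using row \<sigma> by (cases "k = \<sigma> i") (auto, metis surjD)
  have act_g: "act g (u i) = scaleA (a (\<sigma> i) i) (u (\<sigma> i))" for i
  proof -
    have "act g (u i) = (\<Sum>k\<in>UNIV. scaleA (a (\<sigma> i) i) (scaleA (of_bool (k = \<sigma> i)) (u k)))"
      unfolding a[of i] by (rule sum.cong[OF refl], subst col) (simp add: mult.commute)
    then show ?thesis by (simp only: generator_sum[of "\<sigma> i", symmetric] flip: A.scale_sum_right)
  qed
  have "p (\<sigma> i) (\<sigma> j) = p i j" for i j
  proof (cases "i = j")
    case True
    then show ?thesis by (simp add: parameters)
  next
    case False
    then have ne: "\<sigma> i \<noteq> \<sigma> j" using inj by (auto dest: injD)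
    have zero: "a (\<sigma> i) j = 0" "a (\<sigma> j) i = 0"
      using col[of "\<sigma> i" j] col[of "\<sigma> j" i] ne by simp_all
    have "p (\<sigma> i) (\<sigma> j) * (a (\<sigma> i) i * a (\<sigma> j) j) - p i j * (a (\<sigma> j) j * a (\<sigma> i) i) = 0"
      using quantum_affine_space_quadratic(2)[OF space quad[of i j], of "\<sigma> i" "\<sigma> j"] zero by simp
    then have "(p (\<sigma> i) (\<sigma> j) - p i j) * (a (\<sigma> i) i * a (\<sigma> j) j) = 0"
      by (simp add: algebra_simps)
    then show ?thesis using \<sigma> by simp
  qed
  with inj \<sigma> act_g show thesis by (intro that[of \<sigma> "\<lambda>i. a (\<sigma> i) i"]) auto
qed

lemma coefficients:
  obtains \<sigma> \<alpha> b where "\<And>i. act g (u i) = scaleA (\<alpha> i) (u (\<sigma> i))"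
    "\<And>j. act x (u j) = (\<Sum>k\<in>UNIV. scaleA (b k j) (u k))"
    "taft_coefficients p \<sigma> \<alpha> b lam"
proof -
  obtain \<sigma> \<alpha> where \<sigma>: "inj \<sigma>" and \<alpha>: "\<And>i. \<alpha> i \<noteq> 0"
    and g: "\<And>i. act g (u i) = scaleA (\<alpha> i) (u (\<sigma> i))"
    and aut: "\<And>i j. p (\<sigma> i) (\<sigma> j) = p i j"
    using act_g_monomial by blast
  obtain b where b: "act x (u j) = (\<Sum>k\<in>UNIV. scaleA (b k j) (u k))" for j
    using linear_coefficients[of x] linear_act by (auto simp: linear_action_def)
  have g': "act g (u i) = (\<Sum>k\<in>UNIV. scaleA (of_bool (k = \<sigma> i) * \<alpha> i) (u k))" for i
  proof -
    have "act g (u i) = scaleA (\<alpha> i) (\<Sum>k\<in>UNIV. scaleA (of_bool (k = \<sigma> i)) (u k))"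
      by (simp only: g generator_sum[of "\<sigma> i", symmetric])
    then show ?thesis by (simp add: A.scale_sum_right mult.commute)
  qed
  have "taft_coefficients p \<sigma> \<alpha> b lam"
  proof
    show "p i i = 1" "p i j * p j i = 1" for i j by (rule parameters)+
    show "p i j * p i j \<noteq> 1" if "i \<noteq> j" for i j using mult_ord_ge_3D(2) ord_ge[OF that] .
    show "i = j" if "\<sigma> i = \<sigma> j" for i j using \<sigma> that by (rule injD)
    show "\<alpha> i \<noteq> 0" "p (\<sigma> i) (\<sigma> j) = p i j" for i j by (rule \<alpha>, rule aut)
    have "mult_ord lam = m" using taft by (simp add: generalized_taft_def primitive_root_of_unity_def)
    then show "lam * lam \<noteq> 1" using mult_ord_ge_3D(2)[of lam] m_ge by simp
    show "p k l * relation_coeff p \<sigma> \<alpha> b i j k l + relation_coeff p \<sigma> \<alpha> b i j l k = 0" for i j k l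
    proof (rule quantum_affine_space_quadratic(2)[OF space])
      have prod: "act x (u i * u j) = (\<Sum>k\<in>UNIV. \<Sum>l\<in>UNIV.
          scaleA (of_bool (k = \<sigma> i) * \<alpha> i * b l j + b k i * of_bool (l = j)) (u k * u l))" for i j
      proof -
        have "act x (u i * u j) = act g (u i) * act x (u j) + act x (u i) * u j"
          by (rule act_skew_primitive_mult[OF skew_x])
        also have "act x (u i) * u j = act x (u i) * (\<Sum>l\<in>UNIV. scaleA (of_bool (l = j)) (u l))"
          by (simp only: generator_sum[of j, symmetric])
        finally show ?thesis
          by (simp only: g' b sum_mult_sum A.scale_left_distrib sum.distrib)
      qed
      have "act x (u i * u j) = act x (scaleA (p i j) (u j * u i))"
        by (simp only: quantum_relation[of i j])
      then have "act x (u i * u j) - scaleA (p i j) (act x (u j * u i)) = 0"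
        by (simp add: act_scale_right)
      then show "(\<Sum>k\<in>UNIV. \<Sum>l\<in>UNIV. scaleA (relation_coeff p \<sigma> \<alpha> b i j k l) (u k * u l)) = 0"
        by (simp only: prod relation_coeff_def A.scale_sum_right A.scale_scale
            A.scale_left_diff_distrib sum_subtractf)
    qed
    show "\<alpha> k * b k i = lam * \<alpha> i * b (\<sigma> k) (\<sigma> i)" for k i
    proof -
      have "bij \<sigma>" using \<sigma> by (simp add: bij_betw_def finite_UNIV_inj_surj)
      have "act (g * x) (u i) = act (scaleH lam (x * g)) (u i)" by (simp only: taft_relations(3))
      then have "(\<Sum>k\<in>UNIV. scaleA (b k i * \<alpha> k) (u (\<sigma> k))) =
          (\<Sum>k\<in>UNIV. scaleA (lam * \<alpha> i * b k (\<sigma> i)) (u k))"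
        by (simp add: act_mult_left act_scale_left act_scale_right act_sum_right g b
            A.scale_sum_right mult.assoc)
      moreover have "(\<Sum>k\<in>UNIV. scaleA (b k i * \<alpha> k) (u (\<sigma> k))) =
          (\<Sum>k\<in>UNIV. scaleA (b (inv \<sigma> k) i * \<alpha> (inv \<sigma> k)) (u k))"
        using sum.reindex_bij_betw[OF \<open>bij \<sigma>\<close>,
            of "\<lambda>k. scaleA (b (inv \<sigma> k) i * \<alpha> (inv \<sigma> k)) (u k)"] \<sigma> by simp
      ultimately have "b (inv \<sigma> (\<sigma> k)) i * \<alpha> (inv \<sigma> (\<sigma> k)) = lam * \<alpha> i * b (\<sigma> k) (\<sigma> i)"
        by (intro linear_independent) simp
      then show ?thesis using \<sigma> by (simp add: mult.commute)
    qed
  qed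
  with g b show thesis by (rule that)
qed

lemma diagonal_coefficients:
  obtains \<alpha> b where "\<And>i. act g (u i) = scaleA (\<alpha> i) (u i)"
    "\<And>j. act x (u j) = (\<Sum>k\<in>UNIV. scaleA (b k j) (u k))"
    "diagonal_taft_coefficients p \<alpha> b lam" "\<exists>k j. b k j \<noteq> 0"
proof -
  obtain \<sigma> \<alpha> b where g: "\<And>i. act g (u i) = scaleA (\<alpha> i) (u (\<sigma> i))"
    and b: "\<And>j. act x (u j) = (\<Sum>k\<in>UNIV. scaleA (b k j) (u k))"
    and coeffs: "taft_coefficients p \<sigma> \<alpha> b lam"
    by (rule coefficients, rule that)
  have nz: "\<exists>k j. b k j \<noteq> 0"
  proof (rule ccontr)
    assume "\<nexists>k j. b k j \<noteq> 0"
    then have "act x (u j) = 0" for j by (simp add: b)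
    then show False using act_x_nonzero by blast
  qed
  then have "\<sigma> = id"
    using taft_coefficients.vanish_if_moved[OF coeffs] by (metis eq_id_iff)
  with g b nz coeffs show thesis
    by (intro that[of \<alpha> b]) (auto simp: diagonal_taft_coefficients_def)
qed

text \<open>
  The elements of the subalgebra that \<open>g\<close> and \<open>x\<close> map back into it form a subalgebra, by the
  product rules for \<open>g\<close> and \<open>x\<close>, so stability need only be checked on the generators.
\<close>

lemma trivial_extensionI:
  assumes g: "\<And>i. i \<in> I \<Longrightarrow> act g (u i) \<in> generated_subalgebra scaleA u I"
    and x: "\<And>i. i \<in> I \<Longrightarrow> act x (u i) \<in> generated_subalgebra scaleA u I"
    and x0: "\<And>i. i \<notin> I \<Longrightarrow> act x (u i) = 0"
  shows "trivial_extension scaleA u act x I"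
proof -
  let ?B = "generated_subalgebra scaleA u I"
  note B = subalgebra_generated[OF A.k_algebra_axioms, of u I]
  have closed: "0 \<in> ?B" "1 \<in> ?B" "\<And>a b. a \<in> ?B \<Longrightarrow> b \<in> ?B \<Longrightarrow> a + b \<in> ?B"
    "\<And>c a. a \<in> ?B \<Longrightarrow> scaleA c a \<in> ?B" "\<And>a b. a \<in> ?B \<Longrightarrow> b \<in> ?B \<Longrightarrow> a * b \<in> ?B"
    using B by (auto simp: subalgebra_def A.subspace_def)
  have gen: "u i \<in> ?B" if "i \<in> I" for i
    unfolding generated_subalgebra_def using that by (intro hull_inc) auto
  have "subalgebra scaleA hull (u ` I) \<subseteq> {a \<in> ?B. act g a \<in> ?B \<and> act x a \<in> ?B}"
  proof (rule hull_minimal)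
    show "u ` I \<subseteq> {a \<in> ?B. act g a \<in> ?B \<and> act x a \<in> ?B}" using gen g x by auto
    show "subalgebra scaleA {a \<in> ?B. act g a \<in> ?B \<and> act x a \<in> ?B}"
      unfolding subalgebra_def A.subspace_def
      using closed
      by (auto simp: act_add_right act_scale_right act_g_one act_x_one
          act_grouplike_mult[OF grouplike_g] act_skew_primitive_mult[OF skew_x])
  qed
  then have gx: "act g a \<in> ?B" "act x a \<in> ?B" if "a \<in> ?B" for a
    using that by (auto simp: generated_subalgebra_def)
  have "{h. \<forall>a\<in>?B. act h a \<in> ?B} = UNIV"
    using gx closed
    by (intro subalgebra_H_eq_UNIV)
      (auto simp: subalgebra_def H.subspace_def act_add_left act_scale_left act_mult_left act_one_left)
  then show ?thesis using x0 unfolding trivial_extension_def by blast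
qed

theorem classification:
  "(\<exists>i j. i \<noteq> j \<and> plane_extension p lam scaleA u act g x i j) \<or>
   (\<exists>i j k. distinct [i, j, k] \<and> three_space_extension scaleA u act g x i j k)"
proof -
  obtain \<alpha> b where g: "\<And>i. act g (u i) = scaleA (\<alpha> i) (u i)"
    and b: "\<And>j. act x (u j) = (\<Sum>k\<in>UNIV. scaleA (b k j) (u k))"
    and coeffs: "diagonal_taft_coefficients p \<alpha> b lam" and nz: "\<exists>k j. b k j \<noteq> 0"
    by (rule diagonal_coefficients, rule that)
  interpret diagonal_taft_coefficients p \<alpha> b lam by (rule coeffs)
  have edge: "act x (u j) = scaleA (b i j) (u i)" if "b i j \<noteq> 0" for i j
  proof -
    have "(\<Sum>k\<in>UNIV. scaleA (b k j) (u k)) = (\<Sum>k\<in>{i}. scaleA (b k j) (u k))"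
      using edge_target_unique[OF that] by (intro sum.mono_neutral_right) auto
    then show ?thesis by (simp add: b)
  qed
  have no_edge: "act x (u j) = 0" if "\<And>i. b i j = 0" for j using that by (simp add: b)
  have gen0: "0 \<in> generated_subalgebra scaleA u I" for I
    using subalgebra_generated[OF A.k_algebra_axioms, of u I]
    by (simp add: subalgebra_def A.subspace_def)
  have gen: "scaleA c (u i) \<in> generated_subalgebra scaleA u I" if "i \<in> I" for c i I
  proof -
    have "u i \<in> generated_subalgebra scaleA u I"
      unfolding generated_subalgebra_def using that by (intro hull_inc) auto
    then show ?thesis
      using subalgebra_generated[OF A.k_algebra_axioms, of u I]
      by (simp add: subalgebra_def A.subspace_def)
  qed
  show ?thesis
  proof (cases rule: edges_cases)
    case zero
    then show ?thesis using nz by blast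
  next
    case (single i j)
    have ij: "i \<noteq> j" using edge_irrefl single(1) by blast
    have xi: "act x (u l) = 0" if "l \<noteq> j" for l using single(2) that by (intro no_edge) blast
    have "trivial_extension scaleA u act x {i, j}"
      using xi gen gen0 ij edge[OF single(1)] by (intro trivial_extensionI) (auto simp: g)
    moreover have "\<alpha> i = p i j" using edge_eigenvalue_target[OF single(1)] .
    moreover have "\<alpha> j = inverse lam * p i j"
      using edge_weight[OF single(1)] \<open>\<alpha> i = p i j\<close> alpha[of i] by (auto simp: field_simps)
    ultimately have "plane_extension p lam scaleA u act g x i j"
      using xi[OF ij] edge[OF single(1)] single(1) by (auto simp: plane_extension_def g)
    then show ?thesis using ij by blast
  next
    case (path i j k)
    have x0: "act x (u l) = 0" if "l \<noteq> j" "l \<noteq> k" for l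
      using path(4) that by (intro no_edge) blast
    have "trivial_extension scaleA u act x {i, j, k}"
      using x0 gen gen0 path(1) edge[OF path(2)] edge[OF path(3)]
      by (intro trivial_extensionI) (auto simp: g)
    then have "three_space_extension scaleA u act g x i j k"
      using x0 edge[OF path(2)] edge[OF path(3)] path(2,3) g
      unfolding three_space_extension_def by blast
    then show ?thesis using path(1) by blast
  next
    case (cycle i j k)
    \<comment> \<open>around the triangle \<open>x ^ 3\<close> acts on \<open>u i\<close> by a nonzero scalar, but \<open>x\<close> is nilpotent\<close>
    define c where "c = b j k * b i j * b k i"
    have x3: "act (x ^ 3) (u i) = scaleA c (u i)"
      using cycle[THEN edge]
      by (simp add: c_def power3_eq_cube act_mult_left act_scale_right mult_ac)
    have "act ((x ^ 3) ^ r) (u i) = scaleA (c ^ r) (u i)" for r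
      by (induction r) (simp_all add: act_one_left act_mult_left act_scale_right x3 mult.commute)
    moreover have "(x ^ 3) ^ m = (x ^ m) ^ 3"
      by (simp only: mult.commute[of 3] flip: power_mult)
    then have "(x ^ 3) ^ m = 0"
      using taft_relations(2) by simp
    ultimately have "scaleA (c ^ m) (u i) = 0" by (metis act_zero_left)
    then show ?thesis using generator_nonzero cycle by (simp add: c_def)
  qed
qed

end


section \<open>The classification\<close>

theorem theorem3p9:
  fixes lam :: "'k::{alg_closed_field, field_char_0}"
    and n m :: nat
    and scaleH :: "'k \<Rightarrow> 'h::ring_1 \<Rightarrow> 'h"
    and \<Delta> :: "'h \<Rightarrow> ('h \<times> 'h \<Rightarrow>\<^sub>0 'k)"
    and \<epsilon> :: "'h \<Rightarrow> 'k"
    and S :: "'h \<Rightarrow> 'h"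
    and g x :: 'h
    and p :: "'i::finite \<Rightarrow> 'i \<Rightarrow> 'k"
    and scaleA :: "'k \<Rightarrow> 'a::ring_1 \<Rightarrow> 'a"
    and u :: "'i \<Rightarrow> 'a"
    and act :: "'h \<Rightarrow> 'a \<Rightarrow> 'a"
  assumes "generalized_taft n lam m scaleH \<Delta> \<epsilon> S g x"
    and "quantum_affine_space p scaleA u"
    and "\<And>i j. i \<noteq> j \<Longrightarrow> root_of_unity (p i j)"
    and "module_algebra scaleH \<Delta> \<epsilon> S scaleA act"
    and "module_algebra.inner_faithful scaleH \<Delta> \<epsilon> S act"
    and "linear_action scaleA u act g x"
    and "m \<ge> 3"
    and "CARD('i) \<ge> 3"
    and "\<And>i j. i \<noteq> j \<Longrightarrow> mult_ord (p i j) \<ge> 3"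
  shows "(\<exists>i j. i \<noteq> j \<and> plane_extension p lam scaleA u act g x i j) \<or>
         (\<exists>i j k. distinct [i, j, k] \<and> three_space_extension scaleA u act g x i j k)"
proof -
  interpret linear_taft_action scaleH \<Delta> \<epsilon> S scaleA act n m lam g x p u
    using assms by (simp add: linear_taft_action_def linear_taft_action_axioms_def)
  show ?thesis by (rule classification)
qed

end
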